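(* Let $M\geq N\geq W\geq 2$, and fix some $\epsilon>0$. Let $f$ be any multiplicative function such that $0\leq f(p)\leq 1$ and $f(p^m)\leq f(p)$ for all primes $p$ and all $m\geq 2$. Suppose also that for all $X\geq 2$ we have $$\sum_{p\leq X}\frac{f(p)}{p}=\alpha\log\log X+O(1)$$ for some $0<\alpha<1$, the sum being over primes $p\leq X$. Then for any complex sequences $a_n$, $b_m$ which are supported on the odd integers such that $|a_n|\leq 1$ and $|b_m|\leq 1$ we have $$\mathop{\sum\sum}_{W<n\leq N,\;m\leq M}\frac{a_n}{n}b_mf(m)\left(\frac{n}{m}\right)\ll_{\epsilon}\frac{M(\log N)}{W^{1/2}(\log M)^{(1-\alpha)}}+\frac{M^{1/2+\epsilon}N^{1/2}(\log N)^{1/2}}{(\log M)^{(1-\alpha)/2}},$$ where the implied constant depends at most on $\epsilon$.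
   Context: The sums are over positive integers $n$ and $m$, and $\left(\frac{n}{m}\right)$ is the Jacobi symbol for odd positive $m$. The notation $A\ll B$ means $|A|\leq CB$ for a constant $C>0$ with the stated dependence.
   Formalization: The condition f(p^m) ≤ f(p) is taken as |f(p^m)| ≤ f(p), since large negative f(p^m) make the claim false; the constant implied in the O(1) is a fixed bound K, and the final implied constant depends on ε and K. *)

theory Defs
  imports "HOL-Analysis.Analysis" "HOL-Number_Theory.Number_Theory"
begin

(* The usual Jacobi symbol when m is odd; even m carry no intended meaning. *)
definition Jacobi :: "int \<Rightarrow> nat \<Rightarrow> int" where
  "Jacobi n m = (\<Prod>p\<in>#prime_factorization m. Legendre n (int p))"

(* Arithmetic functions live on the positive integers, so the value at 0 is unconstrained. *)
definition multiplicative_fun :: "(nat \<Rightarrow> 'a::comm_semiring_1) \<Rightarrow> bool" where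
  "multiplicative_fun f \<longleftrightarrow>
     f 1 = 1 \<and> (\<forall>m n. m > 0 \<longrightarrow> n > 0 \<longrightarrow> coprime m n \<longrightarrow> f (m * n) = f m * f n)"

(* The condition 0 <= f(p) <= 1, f(p^m) <= f(p) is read with an absolute value on f(p^m):
   without any lower bound, f(p^m) could be an arbitrarily large negative number.
   The common case 0 <= f(p^m) <= f(p) is included. *)
definition admissible :: "(nat \<Rightarrow> real) \<Rightarrow> bool" where
  "admissible f \<longleftrightarrow> multiplicative_fun f \<and>
     (\<forall>p. prime p \<longrightarrow> 0 \<le> f p \<and> f p \<le> 1 \<and> (\<forall>m\<ge>2. \<bar>f (p ^ m)\<bar> \<le> f p))"

(* sum_{p <= X} f(p)/p = \<alpha> log log X + O(1), where K is the constant implied by the O(1). *)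
definition mertens_mean :: "(nat \<Rightarrow> real) \<Rightarrow> real \<Rightarrow> real \<Rightarrow> bool" where
  "mertens_mean f \<alpha> K \<longleftrightarrow>
     (\<forall>X::real\<ge>2. \<bar>(\<Sum>p | prime p \<and> real p \<le> X. f p / real p) - \<alpha> * ln (ln X)\<bar> \<le> K)"

end

theory Submission
  imports Defs "HOL-Computational_Algebra.Squarefree" "HOL-Computational_Algebra.Nth_Powers"
begin

text \<open>
The sum over \<open>m\<close> carries an arbitrary coefficient, so cancellation has to come from the sum over
\<open>n\<close>. Write \<open>A(m)\<close> for the sum of \<open>a\<^sub>n / n\<close> against the Jacobi symbol. The weighted Cauchy--Schwarz
inequality bounds the bilinear form by the square root of \<open>(\<Sum> \<bar>f(m)\<bar>) (\<Sum> \<bar>f(m)\<bar> \<bar>A(m)\<bar>\<^sup>2)\<close>. Keeping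
the weight \<open>\<bar>f(m)\<bar>\<close> in both factors is what saves the full power \<open>(log M) powr (1 - \<alpha>)\<close> in the
first term; the price is that the weight has to be replaced by something that can be summed
against characters.

The replacement is a sieve. For primes up to \<open>z = M powr \<eta>\<close> one has \<open>\<bar>f(m)\<bar> \<le> \<Prod> f(p)\<close> over
the \<open>p \<le> z\<close> dividing \<open>m\<close>, and this product is the probability that \<open>m\<close> survives sieving by a random set \<open>P\<close> of
primes that contains each \<open>p \<le> z\<close> independently with probability \<open>1 - f(p)\<close>. Hence it is
enough to bound unweighted sums over the \<open>m\<close> that are free of prime factors in a given set \<open>P\<close>, with a main
term proportional to the density \<open>V(P) = \<Prod> (1 - 1/p)\<close>, and to average over \<open>P\<close>: the mean of
\<open>V(P)\<close> is \<open>\<Prod> (1 - (1 - f(p))/p)\<close>, which is at most of order \<open>(log z) powr (\<alpha> - 1)\<close> by the hypothesis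
on \<open>f\<close> and the lower bound of Mertens for the sum of the reciprocals of the primes. This is
\<open>random_sieve_average\<close> with \<open>sieve_density_le\<close>.

For a fixed \<open>P\<close> the condition is majorised by a Selberg square \<open>(\<Sum> \<lambda>(d))\<^sup>2\<close> over divisors \<open>d\<close> of
\<open>m\<close> of size at most \<open>z\<^sup>5\<close> (\<open>Selberg_majorant\<close>). Rankin's trick shows that sieving by primes up to
the fifth root of the level already gives the right density, uniformly in \<open>P\<close>.

Now \<open>\<bar>A(m)\<bar>\<^sup>2\<close> can be opened. A pair \<open>n\<^sub>1, n\<^sub>2\<close> whose product is a square gives no cancellation and costs
the sieve main term; such pairs are rare, since they have the form \<open>g u\<^sup>2, g v\<^sup>2\<close>, and they
contribute \<open>(log N) / W\<close> (\<open>diagonal_sum_le\<close>). For every other pair the map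
\<open>m \<mapsto> (n\<^sub>1 n\<^sub>2 / m)\<close> on odd \<open>m\<close> is a nontrivial character, and the Polya--Vinogradov inequality bounds its
sums by about \<open>sqrt (n\<^sub>1 n\<^sub>2)\<close> (\<open>Polya_Vinogradov\<close>), which after division by \<open>n\<^sub>1 n\<^sub>2\<close> adds up to \<open>N log N\<close>.
The divisors in the Selberg square multiply this by at most \<open>z\<^sup>2\<^sup>0\<close>, an arbitrarily small power of \<open>M\<close>.
\<close>

section \<open>The Jacobi symbol and its reciprocity law\<close>

text \<open>
Euler's criterion gives the identity modulo \<open>p\<close>; both sides lie in \<open>{-1, 0, 1}\<close>, so for \<open>p > 2\<close> the
congruence forces equality.
\<close>

lemma Legendre_mult:
  assumes p: "prime p" "2 < p"
  shows "Legendre (a * b) (int p) = Legendre a (int p) * Legendre b (int p)"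
proof -
  let ?e = "(p - 1) div 2"
  have "[Legendre (a * b) p = (a * b) ^ ?e] (mod p)"
    using euler_criterion[OF p] by simp
  also have "[(a * b) ^ ?e = Legendre a p * Legendre b p] (mod p)"
    using cong_mult[OF euler_criterion[OF p, of a] euler_criterion[OF p, of b]]
    by (simp add: power_mult_distrib cong_sym)
  finally have *: "int p dvd Legendre (a * b) p - Legendre a p * Legendre b p"
    by (simp add: cong_iff_dvd_diff)
  have "\<bar>Legendre (a * b) p - Legendre a p * Legendre b p\<bar> < int p"
    using p by (auto simp: Legendre_def)
  with * show ?thesis
    using zdvd_imp_le[of "int p" "\<bar>Legendre (a * b) p - Legendre a p * Legendre b p\<bar>"] by force
qed

lemma Legendre_cong:
  assumes "[a = b] (mod int p)"
  shows "Legendre a (int p) = Legendre b (int p)"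
proof -
  have "[a = 0] (mod int p) \<longleftrightarrow> [b = 0] (mod int p)" "QuadRes (int p) a \<longleftrightarrow> QuadRes (int p) b"
    using assms by (simp_all add: QuadRes_def cong_def)
  then show ?thesis by (simp add: Legendre_def)
qed

lemma odd_prime_gt_2: "prime p \<Longrightarrow> odd p \<Longrightarrow> 2 < (p::nat)"
  using prime_ge_2_nat[of p] by (cases "p = 2") auto

lemma prime_factor_odd:
  assumes "odd m" "p \<in># prime_factorization m"
  shows "prime p" "2 < p" "p dvd (m::nat)"
proof -
  show "prime p" "p dvd m" using assms(2) by auto
  then have "p \<noteq> 2" using assms by auto
  then show "2 < p" using prime_ge_2_nat[OF \<open>prime p\<close>] by linarith
qed

lemma Jacobi_1_right [simp]: "Jacobi a (Suc 0) = 1"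
  by (simp add: Jacobi_def)

lemma Jacobi_prime: "prime p \<Longrightarrow> Jacobi a p = Legendre a (int p)"
  by (simp add: Jacobi_def prime_factorization_prime)

lemma Jacobi_mult_right:
  assumes "m > 0" "n > 0"
  shows "Jacobi a (m * n) = Jacobi a m * Jacobi a n"
  using assms by (simp add: Jacobi_def prime_factorization_mult)

lemma Jacobi_mult_left:
  assumes "odd m"
  shows "Jacobi (a * b) m = Jacobi a m * Jacobi b m"
proof -
  have "image_mset (\<lambda>p. Legendre (a * b) (int p)) (prime_factorization m)
      = image_mset (\<lambda>p. Legendre a (int p) * Legendre b (int p)) (prime_factorization m)"
    by (rule image_mset_cong) (use Legendre_mult prime_factor_odd[OF assms] in blast)
  then show ?thesis by (simp add: Jacobi_def prod_mset.distrib)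
qed

lemma Jacobi_cong:
  assumes "[a = b] (mod int m)"
  shows "Jacobi a m = Jacobi b m"
proof -
  have "image_mset (\<lambda>p. Legendre a (int p)) (prime_factorization m)
      = image_mset (\<lambda>p. Legendre b (int p)) (prime_factorization m)"
  proof (rule image_mset_cong)
    fix p assume "p \<in># prime_factorization m"
    then have "p dvd m" by auto
    then have "[a = b] (mod int p)"
      using assms by (meson cong_dvd_modulus of_nat_dvd_iff)
    then show "Legendre a (int p) = Legendre b (int p)" by (rule Legendre_cong)
  qed
  then show ?thesis by (simp add: Jacobi_def)
qed

lemma prod_mset_sign:
  assumes "\<And>x. x \<in># A \<Longrightarrow> h x \<in> {-1, 0, 1::int}"
  shows "(\<Prod>x\<in>#A. h x) \<in> {-1, 0, 1}"
  using assms
proof (induction A)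
  case (add x A)
  then have "h x \<in> {-1, 0, 1}" "(\<Prod>x\<in>#A. h x) \<in> {-1, 0, 1}" by simp_all
  then show ?case by auto
qed simp

lemma Jacobi_values: "Jacobi a m \<in> {-1, 0, 1}"
  unfolding Jacobi_def by (rule prod_mset_sign) (auto simp: Legendre_def)

lemma Jacobi_eq_0_iff:
  assumes "m > 0"
  shows "Jacobi a m = 0 \<longleftrightarrow> \<not> coprime a (int m)"
proof -
  have "Jacobi a m = 0 \<longleftrightarrow> (\<exists>p\<in>#prime_factorization m. int p dvd a)"
    by (auto simp: Jacobi_def Legendre_def cong_0_iff split: if_splits)
  also have "\<dots> \<longleftrightarrow> (\<exists>p. prime p \<and> p dvd m \<and> int p dvd a)"
    using assms by (auto simp: in_prime_factors_iff)
  also have "\<dots> \<longleftrightarrow> \<not> coprime a (int m)"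
  proof
    assume "\<exists>p. prime p \<and> p dvd m \<and> int p dvd a"
    then obtain p where "prime p" "int p dvd int m" "int p dvd a" by auto
    then show "\<not> coprime a (int m)"
      by (intro not_coprimeI[of "int p"]) auto
  next
    assume "\<not> coprime a (int m)"
    then have "nat (gcd a (int m)) \<noteq> 1"
      by (auto simp: coprime_iff_gcd_eq_1)
    then obtain p where p: "prime p" "p dvd nat (gcd a (int m))" using prime_factor_nat by blast
    then have "int p dvd gcd a (int m)" by (metis gcd_ge_0_int int_dvd_int_iff int_nat_eq)
    with p show "\<exists>p. prime p \<and> p dvd m \<and> int p dvd a" by auto
  qed
  finally show ?thesis .
qed

text \<open>
The sign is multiplicative in each argument, so the law for primes extends by two inductions over
prime factors, one for the lower entry and one for the upper. If the entries share a factor, both symbols vanish.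
\<close>

lemma Jacobi_reciprocity:
  assumes "odd m" "odd n"
  shows "Jacobi (int n) m = (if m mod 4 = 3 \<and> n mod 4 = 3 then -1 else 1) * Jacobi (int m) n"
proof -
  define s where "s m n = (if m mod 4 = 3 \<and> n mod 4 = 3 then -1 else 1 :: int)" for m n :: nat
  have odd4: "m mod 4 = 1 \<or> m mod 4 = 3" if "odd m" for m :: nat
    using that by presburger
  have s_mult: "s (a * b) n = s a n * s b n" if "odd a" "odd b" for a b n
  proof -
    have "(a * b) mod 4 = ((a mod 4) * (b mod 4)) mod 4" by (simp add: mod_mult_eq)
    then show ?thesis
      using odd4[OF that(1)] odd4[OF that(2)] by (elim disjE) (simp_all add: s_def)
  qed
  have s_comm: "s m n = s n m" for m n by (auto simp: s_def)
  have 1: "Legendre (int q) (int p) = s p q * Legendre (int p) (int q)"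
    if "prime p" "prime q" "odd p" "odd q" for p q
  proof (cases "p = q")
    case True
    then show ?thesis by (simp add: Legendre_def cong_0_iff)
  next
    case False
    have gt: "p > 2" "q > 2" using that odd_prime_gt_2 by blast+
    have r: "Legendre p q * Legendre q p = (-1::int) ^ ((p - 1) div 2 * ((q - 1) div 2))"
      by (rule Quadratic_Reciprocity) (use that gt False in auto)
    have par: "even ((p - 1) div 2) \<longleftrightarrow> p mod 4 = 1" if "odd p" for p :: nat
      using that by presburger
    have "(-1::int) ^ ((p - 1) div 2 * ((q - 1) div 2)) = s p q"
      using par[OF \<open>odd p\<close>] par[OF \<open>odd q\<close>] odd4[OF \<open>odd p\<close>] odd4[OF \<open>odd q\<close>]
      by (elim disjE) (simp_all add: s_def minus_one_power_iff)
    moreover have "Legendre (int p) (int q) \<in> {-1, 1}"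
      using False that primes_dvd_imp_eq[of q p] by (auto simp: Legendre_def cong_0_iff)
    ultimately show ?thesis using r
      by (elim insertE emptyE) simp_all
  qed
  have 2: "odd n \<Longrightarrow> Legendre (int n) (int p) = s p n * Jacobi (int p) n" if "prime p" "odd p" for p n
  proof (induction n rule: prime_divisors_induct)
    case zero
    then show ?case by simp
  next
    case (unit x)
    then show ?case using that prime_gt_1_nat[of p]
      by (auto simp: s_def Legendre_def QuadRes_def cong_0_iff intro!: exI[of _ 1])
  next
    case (factor q x)
    then have "odd q" "odd x" "x > 0" by (auto intro: odd_pos)
    have "p > 2" using that odd_prime_gt_2 by blast
    then have "Legendre (int (q * x)) (int p) = Legendre (int q) (int p) * Legendre (int x) (int p)"
      using Legendre_mult[OF that(1)] by simp
    also have "\<dots> = (s p q * Jacobi (int p) q) * (s p x * Jacobi (int p) x)"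
      using factor \<open>odd x\<close> \<open>odd q\<close> 1[OF that(1) factor(1) that(2)] by (simp add: Jacobi_prime)
    also have "\<dots> = s p (q * x) * Jacobi (int p) (q * x)"
      using s_mult[OF \<open>odd q\<close> \<open>odd x\<close>] \<open>x > 0\<close> prime_gt_0_nat[OF factor(1)]
      by (simp add: s_comm[of p] Jacobi_mult_right)
    finally show ?case .
  qed
  have "odd m \<Longrightarrow> Jacobi (int n) m = s m n * Jacobi (int m) n"
  proof (induction m rule: prime_divisors_induct)
    case zero
    then show ?case by simp
  next
    case (unit x)
    have "Jacobi 1 n = 1"
      using Jacobi_mult_left[OF assms(2), of 1 1] Jacobi_eq_0_iff[of n 1] odd_pos[OF assms(2)] by simp
    then show ?case using unit by (auto simp: s_def)
  next
    case (factor q x)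
    then have "odd q" "odd x" "x > 0" by (auto intro: odd_pos)
    then show ?case
      using factor 2[OF factor(1) \<open>odd q\<close> assms(2)] prime_gt_0_nat[OF factor(1)] s_mult
      by (simp add: Jacobi_mult_right Jacobi_prime Jacobi_mult_left[OF assms(2)])
  qed
  with assms show ?thesis by (simp add: s_def)
qed

text \<open>
Otherwise squaring would be onto, hence injective, on the residues modulo \<open>p\<close>; but \<open>1\<close> and \<open>-1\<close>
have the same square.
\<close>

lemma exists_nonresidue:
  assumes "prime p" "2 < p"
  shows "\<exists>c. Legendre c (int p) = -1"
proof (rule ccontr)
  assume contr: "\<nexists>c. Legendre c (int p) = -1"
  let ?A = "{0..<int p}"
  have res: "\<exists>y. [y ^ 2 = c] (mod int p)" for c
  proof (cases "[c = 0] (mod int p)")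
    case True
    then show ?thesis by (intro exI[of _ 0]) (simp add: cong_sym)
  next
    case False
    then show ?thesis using contr by (auto simp: Legendre_def QuadRes_def split: if_splits)
  qed
  have "?A \<subseteq> (\<lambda>y. y ^ 2 mod int p) ` ?A"
  proof
    fix c assume c: "c \<in> ?A"
    obtain y where "[y ^ 2 = c] (mod int p)" using res by blast
    then have "(y mod int p) ^ 2 mod int p = c" using c by (simp add: cong_def power_mod)
    then show "c \<in> (\<lambda>y. y ^ 2 mod int p) ` ?A"
      using assms by (intro image_eqI[of _ _ "y mod int p"]) auto
  qed
  then have "card ?A \<le> card ((\<lambda>y. y ^ 2 mod int p) ` ?A)"
    by (rule card_mono[OF finite_imageI, rotated]) simp
  then have "card ((\<lambda>y. y ^ 2 mod int p) ` ?A) = card ?A"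
    using card_image_le[of ?A "\<lambda>y. y ^ 2 mod int p"] by simp
  then have "inj_on (\<lambda>y. y ^ 2 mod int p) ?A"
    by (rule eq_card_imp_inj_on[rotated]) simp
  moreover have "(1::int) ^ 2 mod int p = (int p - 1) ^ 2 mod int p"
    by (simp add: power2_diff mod_eq_dvd_iff)
  moreover have "1 \<in> ?A" "int p - 1 \<in> ?A" using assms by auto
  ultimately have "(1::int) = int p - 1"
    by (rule inj_onD)
  then show False using assms by simp
qed

text \<open>
Primitivity of the character modulo a squarefree \<open>q\<close>: it is not determined by any proper
divisor \<open>q / p\<close> of the modulus. The Chinese remainder theorem combines a nonresidue modulo \<open>p\<close> with \<open>1\<close>
modulo \<open>q / p\<close>.
\<close>

lemma exists_Jacobi_minus_1_twist:
  fixes q p :: nat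
  assumes "squarefree q" "odd q" "prime p" "p dvd q"
  shows "\<exists>u. coprime u (int q) \<and> [u = 1] (mod int (q div p)) \<and> Jacobi u q = -1"
proof -
  define r where "r = q div p"
  have q: "q = p * r" using assms by (simp add: r_def)
  have "p > 2" using assms odd_prime_gt_2 by (meson dvd_trans)
  have "\<not> p dvd r"
  proof
    assume "p dvd r"
    then have "p ^ 2 dvd q" unfolding q power2_eq_square by (rule mult_dvd_mono[OF dvd_refl])
    then show False using assms squarefreeD[OF assms(1)] not_prime_unit by blast
  qed
  then have cop: "coprime p r" using assms prime_imp_coprime by blast
  have "r > 0" using assms(2) q by (intro odd_pos) auto
  obtain c where c: "Legendre c (int p) = -1" using exists_nonresidue[OF assms(3) \<open>p > 2\<close>] by blast
  obtain u where u: "[u = c] (mod int p)" "[u = 1] (mod int r)"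
    using binary_chinese_remainder_int[of "int p" "int r" c 1] cop by auto
  have "Jacobi 1 r = 1"
    using Jacobi_mult_left[of r 1 1] Jacobi_eq_0_iff[of r 1] \<open>r > 0\<close> assms(2) q by simp
  then have "Jacobi u q = -1"
    using Jacobi_cong[OF u(2)] Legendre_cong[OF u(1)] c \<open>r > 0\<close> prime_gt_0_nat[OF assms(3)]
    by (simp add: q Jacobi_mult_right Jacobi_prime assms)
  moreover from this have "coprime u (int q)"
    using Jacobi_eq_0_iff[of q u] odd_pos[OF assms(2)] by auto
  ultimately show ?thesis using u by (auto simp: r_def)
qed

section \<open>Gauss sums of quadratic characters\<close>

lemma sum_dilate_mod:
  fixes F :: "int \<Rightarrow> 'a::comm_monoid_add"
  assumes q: "q > 0" and u: "coprime u (int q)"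
    and per: "\<And>a b. [a = b] (mod int q) \<Longrightarrow> F a = F b"
  shows "(\<Sum>c\<in>{0..<int q}. F (u * c)) = (\<Sum>c\<in>{0..<int q}. F c)"
proof -
  let ?I = "{0..<int q}"
  have inj: "inj_on (\<lambda>c. u * c mod int q) ?I"
  proof (rule inj_onI)
    fix x y assume xy: "x \<in> ?I" "y \<in> ?I" "u * x mod int q = u * y mod int q"
    then have "[x = y] (mod int q)"
      using cong_mult_lcancel[OF u] by (simp add: cong_def)
    with xy show "x = y" by (simp add: cong_def)
  qed
  have "(\<lambda>c. u * c mod int q) ` ?I = ?I"
    by (rule endo_inj_surj) (use q inj in auto)
  then have "(\<Sum>c\<in>?I. F c) = (\<Sum>c\<in>?I. F (u * c mod int q))"
    using sum.reindex[OF inj, of F] by simp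
  also have "\<dots> = (\<Sum>c\<in>?I. F (u * c))"
    by (intro sum.cong per) (auto simp: cong_def)
  finally show ?thesis by simp
qed

definition add_char :: "nat \<Rightarrow> int \<Rightarrow> complex" where
  "add_char q a = cis (2 * pi * (of_int a / of_nat q))"

lemma add_char_0 [simp]: "add_char q 0 = 1"
  by (simp add: add_char_def)

lemma add_char_add: "add_char q (a + b) = add_char q a * add_char q b"
  by (simp add: add_char_def cis_mult add_divide_distrib distrib_left)

lemma norm_add_char [simp]: "norm (add_char q a) = 1"
  by (simp add: add_char_def)

lemma cnj_add_char: "cnj (add_char q a) = add_char q (- a)"
  by (simp add: add_char_def cis_cnj)

lemma add_char_eq_1: 
  assumes "q > 0" "int q dvd a"
  shows "add_char q a = 1"
proof -
  obtain k where "a = int q * k" using assms(2) by blast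
  then have "of_int a / real q = of_int k" using assms by simp
  then show ?thesis unfolding add_char_def by (metis Ints_of_int cis_multiple_2pi)
qed

lemma add_char_cong:
  assumes "q > 0" "[a = b] (mod int q)"
  shows "add_char q a = add_char q b"
proof -
  have "add_char q (b + (a - b)) = add_char q b"
    unfolding add_char_add using assms add_char_eq_1[of q "a - b"] by (simp add: cong_iff_dvd_diff)
  then show ?thesis by simp
qed

lemma add_char_mult_nat: "add_char q (a * int j) = add_char q a ^ j"
proof (induction j)
  case (Suc j)
  have "add_char q (a * int (Suc j)) = add_char q (a + a * int j)" by (simp add: algebra_simps)
  then show ?case using Suc by (simp add: add_char_add)
qed simp

lemma add_char_power_q: 
  assumes "q > 0" shows "add_char q a ^ q = 1"
  using add_char_eq_1[OF assms, of "a * int q"] by (simp add: add_char_mult_nat)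

lemma sin_ge_linear:
  assumes "0 \<le> x" "x \<le> pi / 2"
  shows "sin x \<ge> 2 / pi * x"
proof -
  have conc: "concave_on {0..pi/2} sin"
    by (rule f''_le0_imp_concave[where f' = cos and f'' = "\<lambda>x. - sin x"])
       (auto intro!: derivative_eq_intros sin_ge_zero)
  have "sin ((1 - 2 / pi * x) *\<^sub>R 0 + (2 / pi * x) *\<^sub>R (pi / 2)) \<ge> (1 - 2 / pi * x) * sin 0 + (2 / pi * x) * sin (pi / 2)"
    by (rule concave_onD[OF conc]) (use assms in \<open>auto simp: field_simps\<close>)
  then show ?thesis by simp
qed

lemma norm_1_minus_cis: "norm (1 - cis t) = 2 * \<bar>sin (t / 2)\<bar>"
proof -
  have "(norm (1 - cis t))\<^sup>2 = (1 - cos t)\<^sup>2 + (sin t)\<^sup>2"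
    by (simp add: cmod_power2)
  also have "\<dots> = 2 - 2 * cos t"
    using sin_cos_squared_add[of t] by (simp add: power2_diff)
  also have "\<dots> = (2 * \<bar>sin (t / 2)\<bar>)\<^sup>2"
    using cos_double_sin[of "t / 2"] by (simp add: power_mult_distrib)
  finally show ?thesis by (rule power2_eq_imp_eq) auto
qed

text \<open>
The distance from \<open>c / q\<close> to the nearest integer is \<open>min (c / q) (1 - c / q)\<close>; bounding the
reciprocal of the minimum by the sum of the two reciprocals makes the later sum over \<open>c\<close> harmonic.
\<close>

lemma norm_1_minus_add_char_ge:
  assumes "0 < c" "c < int q"
  shows "inverse (norm (1 - add_char q c)) \<le> (real q / 4) * (1 / of_int c + 1 / of_int (int q - c))"
proof -
  define t where "t = of_int c / real q"
  have t: "0 < t" "t < 1" using assms by (auto simp: t_def divide_simps)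
  have *: "min t (1 - t) \<le> \<bar>sin (pi * t)\<bar> / 2"
  proof (cases "t \<le> 1 / 2")
    case True
    have "sin (pi * t) \<ge> 2 / pi * (pi * t)" by (rule sin_ge_linear) (use t True in auto)
    then show ?thesis using t by (auto simp: min_def)
  next
    case False
    have "sin (pi * (1 - t)) \<ge> 2 / pi * (pi * (1 - t))" by (rule sin_ge_linear) (use t False in auto)
    moreover have "sin (pi * (1 - t)) = sin (pi * t)" by (simp add: right_diff_distrib)
    ultimately show ?thesis using t by (auto simp: min_def)
  qed
  have n: "norm (1 - add_char q c) = 2 * \<bar>sin (pi * t)\<bar>"
    by (simp add: add_char_def norm_1_minus_cis t_def)
  have pos: "min t (1 - t) > 0" using t by simp
  have "inverse (norm (1 - add_char q c)) \<le> inverse (4 * min t (1 - t))"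
    by (rule le_imp_inverse_le) (use * pos n in auto)
  also have "\<dots> = (1 / 4) * (1 / min t (1 - t))"
    by (simp add: inverse_eq_divide)
  also have "\<dots> \<le> (1 / 4) * (1 / t + 1 / (1 - t))"
    using t by (intro mult_left_mono) (auto simp: min_def)
  also have "\<dots> = (real q / 4) * (1 / of_int c + 1 / of_int (int q - c))"
  proof -
    have "1 / t = real q / of_int c" "1 / (1 - t) = real q / of_int (int q - c)"
      using assms by (auto simp: t_def divide_simps)
    then show ?thesis by (simp add: algebra_simps)
  qed
  finally show ?thesis .
qed

lemma add_char_neq_1:
  assumes "0 < c" "c < int q"
  shows "add_char q c \<noteq> 1"
proof
  assume "add_char q c = 1"
  then have "sin (pi * (of_int c / real q)) = 0"
    using norm_1_minus_cis[of "2 * pi * (of_int c / real q)"] by (simp add: add_char_def)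
  moreover have "sin (pi * (of_int c / real q)) > 0"
    by (rule sin_gt_zero) (use assms in \<open>auto simp: field_simps\<close>)
  ultimately show False by simp
qed

lemma add_char_mod: "q > 0 \<Longrightarrow> add_char q (a mod int q) = add_char q a"
  by (rule add_char_cong) auto

lemma norm_geometric_sum_add_char:
  assumes "0 < c" "c < int q"
  shows "norm (\<Sum>j<J. add_char q (c * int j)) \<le> (real q / 2) * (1 / of_int c + 1 / of_int (int q - c))"
proof -
  let ?z = "add_char q c"
  have "norm (\<Sum>j<J. add_char q (c * int j)) = norm (1 - ?z ^ J) / norm (1 - ?z)"
    using add_char_neq_1[OF assms]
    by (simp add: add_char_mult_nat sum_gp_strict norm_divide)
  also have "\<dots> = norm (1 - ?z ^ J) * inverse (norm (1 - ?z))"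
    by (simp add: divide_inverse)
  also have "\<dots> \<le> 2 * ((real q / 4) * (1 / of_int c + 1 / of_int (int q - c)))"
  proof (intro mult_mono norm_1_minus_add_char_ge assms)
    show "norm (1 - ?z ^ J) \<le> 2"
      using norm_triangle_ineq4[of 1 "?z ^ J"] by (simp add: norm_power)
  qed auto
  finally show ?thesis by simp
qed

lemma add_char_orthogonality:
  assumes "q > 0"
  shows "(\<Sum>b\<in>{0..<int q}. add_char q (b * c)) = (if int q dvd c then of_nat q else 0)"
proof -
  have "(\<Sum>b\<in>{0..<int q}. add_char q (b * c)) = (\<Sum>j<q. add_char q (c * int j))"
    by (rule sum.reindex_bij_witness[of _ int nat]) (auto simp: mult.commute)
  also have "\<dots> = (\<Sum>j<q. add_char q c ^ j)" by (simp add: add_char_mult_nat)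
  also have "\<dots> = (if int q dvd c then of_nat q else 0)"
  proof (cases "int q dvd c")
    case True
    then show ?thesis by (simp add: add_char_eq_1[OF assms])
  next
    case False
    then have "c mod int q \<noteq> 0" by (simp add: dvd_eq_mod_eq_0)
    moreover have "0 \<le> c mod int q" "c mod int q < int q" using assms by simp_all
    ultimately have "add_char q (c mod int q) \<noteq> 1" by (intro add_char_neq_1) linarith+
    then have "add_char q c \<noteq> 1" using add_char_mod[OF assms] by simp
    then show ?thesis using False add_char_power_q[OF assms] by (simp add: sum_gp_strict)
  qed
  finally show ?thesis .
qed

definition gauss_sum :: "nat \<Rightarrow> int \<Rightarrow> complex" where
  "gauss_sum q b = (\<Sum>c\<in>{0..<int q}. of_int (Jacobi c q) * add_char q (b * c))"

lemma gauss_summand_cong: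
  assumes "q > 0" "[c = d] (mod int q)"
  shows "of_int (Jacobi c q) * add_char q (b * c) = of_int (Jacobi d q) * add_char q (b * d)"
  using Jacobi_cong[OF assms(2)] add_char_cong[OF assms(1) cong_scalar_left[OF assms(2)], of b] by simp

text \<open>
A prime \<open>p\<close> dividing both \<open>b\<close> and \<open>q\<close> makes \<open>c \<mapsto> e(b c / q)\<close> periodic modulo \<open>q / p\<close>, while
the character changes sign under multiplication by a suitable \<open>u\<close> congruent to \<open>1\<close> modulo \<open>q / p\<close>. Substituting
\<open>u c\<close> for \<open>c\<close> therefore negates the sum. The case \<open>b = 0\<close>, \<open>q > 1\<close> is the orthogonality of the character to the
trivial one.
\<close>

lemma gauss_sum_not_coprime:
  assumes "squarefree q" "odd q" "\<not> coprime b (int q)"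
  shows "gauss_sum q b = 0"
proof -
  have q: "q > 0" using assms(2) by (rule odd_pos)
  have "nat (gcd b (int q)) \<noteq> 1" using assms(3) by (auto simp: coprime_iff_gcd_eq_1)
  then obtain p where p: "prime p" "p dvd nat (gcd b (int q))" using prime_factor_nat by blast
  then have "int p dvd gcd b (int q)" by (metis gcd_ge_0_int int_dvd_int_iff int_nat_eq)
  then have pb: "int p dvd b" and pq: "p dvd q" by auto
  obtain u where u: "coprime u (int q)" "[u = 1] (mod int (q div p))" "Jacobi u q = -1"
    using exists_Jacobi_minus_1_twist[OF assms(1,2) p(1) pq] by blast
  let ?F = "\<lambda>c. of_int (Jacobi c q) * add_char q (b * c)"
  have "q = p * (q div p)" using pq by simp
  have "int q dvd b * (u - 1)"
  proof -
    have "int p * int (q div p) dvd b * (u - 1)"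
      using u(2) pb by (intro mult_dvd_mono) (auto simp: cong_iff_dvd_diff)
    then show ?thesis using \<open>q = p * (q div p)\<close> by (metis of_nat_mult)
  qed
  then have bu: "[b * (u * c) = b * c] (mod int q)" for c
  proof -
    have "b * (u * c) - b * c = b * (u - 1) * c" by (simp add: algebra_simps)
    then show ?thesis
      using \<open>int q dvd b * (u - 1)\<close> by (simp only: cong_iff_dvd_diff) (rule dvd_mult2)
  qed
  have "gauss_sum q b = (\<Sum>c\<in>{0..<int q}. ?F (u * c))"
    unfolding gauss_sum_def
    by (rule sum_dilate_mod[OF q u(1), symmetric])
       (rule gauss_summand_cong[OF q])
  also have "\<dots> = - gauss_sum q b"
    unfolding gauss_sum_def sum_negf[symmetric]
    using u(3) by (intro sum.cong) (auto simp: Jacobi_mult_left[OF assms(2)] add_char_cong[OF q bu])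
  finally show ?thesis by simp
qed

lemma norm_gauss_sum_coprime:
  assumes "odd q" "coprime b (int q)"
  shows "norm (gauss_sum q b) = norm (gauss_sum q 1)"
proof -
  have q: "q > 0" using assms(1) by (rule odd_pos)
  let ?F = "\<lambda>c. of_int (Jacobi c q) * add_char q (1 * c)"
  have "gauss_sum q 1 = (\<Sum>c\<in>{0..<int q}. ?F (b * c))"
    unfolding gauss_sum_def
    by (rule sum_dilate_mod[OF q assms(2), symmetric])
       (rule gauss_summand_cong[OF q])
  also have "\<dots> = of_int (Jacobi b q) * gauss_sum q b"
    unfolding gauss_sum_def sum_distrib_left
    by (intro sum.cong) (auto simp: Jacobi_mult_left[OF assms(1)])
  finally have "norm (gauss_sum q 1) = norm (of_int (Jacobi b q) :: complex) * norm (gauss_sum q b)"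
    by (simp add: norm_mult)
  moreover have "Jacobi b q = 1 \<or> Jacobi b q = -1"
    using Jacobi_values[of b q] Jacobi_eq_0_iff[OF q, of b] assms(2) by auto
  ultimately show ?thesis by auto
qed

text \<open>
All Gauss sums with \<open>b\<close> coprime to \<open>q\<close> have the same modulus, and by Parseval the squares of the
moduli add up to \<open>q\<close> times the number of such \<open>b\<close>. This avoids evaluating Gauss sums for composite
moduli.
\<close>

lemma norm_gauss_sum_le:
  assumes "squarefree q" "odd q"
  shows "norm (gauss_sum q b) \<le> sqrt q"
proof -
  have q: "q > 0" using assms(2) by (rule odd_pos)
  let ?I = "{0..<int q}"
  let ?X = "\<lambda>c. of_int (Jacobi c q) :: complex"
  define U where "U = {c\<in>?I. coprime c (int q)}"
  have sq: "(gauss_sum q b) * cnj (gauss_sum q b)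
      = (\<Sum>c\<in>?I. \<Sum>d\<in>?I. ?X c * ?X d * add_char q (b * (c - d)))" for b
    unfolding gauss_sum_def cnj_sum sum_product
    by (intro sum.cong refl) (simp add: cnj_add_char add_char_add[symmetric] algebra_simps)
  have "(\<Sum>b\<in>?I. (gauss_sum q b) * cnj (gauss_sum q b))
      = (\<Sum>c\<in>?I. \<Sum>d\<in>?I. ?X c * ?X d * (\<Sum>b\<in>?I. add_char q (b * (c - d))))"
    unfolding sq sum_distrib_left
    by (subst sum.swap, rule sum.cong[OF refl], subst sum.swap, rule refl)
  also have "\<dots> = (\<Sum>c\<in>?I. \<Sum>d\<in>?I. if d = c then ?X c * ?X c * of_nat q else 0)"
  proof (intro sum.cong refl)
    fix c d assume "c \<in> ?I" "d \<in> ?I"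
    then have "int q dvd c - d \<longleftrightarrow> d = c"
      by (auto simp: mod_eq_dvd_iff[symmetric])
    then show "?X c * ?X d * (\<Sum>b\<in>?I. add_char q (b * (c - d))) = (if d = c then ?X c * ?X c * of_nat q else 0)"
      by (simp add: add_char_orthogonality[OF q])
  qed
  also have "\<dots> = (\<Sum>c\<in>?I. if coprime c (int q) then of_nat q else 0)"
    using Jacobi_values[of _ q] Jacobi_eq_0_iff[OF q]
    by (intro sum.cong refl) (fastforce simp: sum.delta)
  also have "\<dots> = of_nat q * of_nat (card U)"
    by (simp add: U_def sum.If_cases Int_def conj_commute mult.commute)
  finally have "(\<Sum>b\<in>?I. of_real ((norm (gauss_sum q b))\<^sup>2)) = complex_of_real (real q * real (card U))"
    by (simp add: complex_norm_square del: of_real_power)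
  then have parseval: "(\<Sum>b\<in>?I. (norm (gauss_sum q b))\<^sup>2) = real q * real (card U)"
    unfolding of_real_sum[symmetric] of_real_eq_iff .
  have "real (card U) * (norm (gauss_sum q 1))\<^sup>2 = (\<Sum>b\<in>U. (norm (gauss_sum q b))\<^sup>2)"
  proof -
    have "(\<Sum>b\<in>U. (norm (gauss_sum q b))\<^sup>2) = (\<Sum>b\<in>U. (norm (gauss_sum q 1))\<^sup>2)"
      by (intro sum.cong refl) (simp only: U_def mem_Collect_eq norm_gauss_sum_coprime[OF assms(2)])
    then show ?thesis by simp
  qed
  also have "\<dots> \<le> (\<Sum>b\<in>?I. (norm (gauss_sum q b))\<^sup>2)"
    by (intro sum_mono2) (auto simp: U_def)
  finally have "real (card U) * (norm (gauss_sum q 1))\<^sup>2 \<le> real (card U) * real q"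
    unfolding parseval by (simp add: mult.commute)
  moreover have "finite U" "1 mod int q \<in> U" using q by (auto simp: U_def intro: finite_subset[of _ ?I])
  then have "card U > 0" by (auto simp: card_gt_0_iff)
  ultimately have "(norm (gauss_sum q 1))\<^sup>2 \<le> real q" by simp
  then have "norm (gauss_sum q 1) \<le> sqrt q" by (rule real_le_rsqrt)
  then show ?thesis
    using norm_gauss_sum_coprime[OF assms(2), of b] gauss_sum_not_coprime[OF assms, of b]
    by (cases "coprime b (int q)") auto
qed

section \<open>The Polya--Vinogradov inequality for Jacobi symbols\<close>

lemma harm_le_1_plus_ln:
  assumes "n > 0"
  shows "harm n \<le> 1 + ln (real n)"
proof -
  obtain k where n: "n = Suc k" using assms by (cases n) auto
  have "harm (Suc k) - ln (real (Suc k)) \<le> harm (Suc 0) - ln (real (Suc 0))"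
    using decseqD[OF decseq_harm_diff_ln, of 0 k] by simp
  then show ?thesis by (simp add: n harm_def)
qed

text \<open>
Expanding the character in additive characters turns the sum into Gauss sums times geometric sums
with ratio \<open>e(4 b / q)\<close>. As \<open>4\<close> is invertible modulo \<open>q\<close>, the classes \<open>4 b\<close> run over all residues, and the geometric
sums contribute \<open>q\<close> times a harmonic number. The frequency \<open>b = 0\<close>, the only one without decay,
has a vanishing Gauss sum.
\<close>

lemma Jacobi_progression_sum:
  assumes "squarefree q" "odd q" "q > 1"
  shows "\<bar>\<Sum>j<J. real_of_int (Jacobi (4 * int j + r) q)\<bar> \<le> sqrt q * (1 + ln q)"
proof -
  have q: "q > 0" using assms by simp
  let ?I = "{0..<int q}"
  have "coprime (2 ^ 2) (int q)" using assms(2)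
    by (subst coprime_power_left_iff) simp
  then have four: "coprime 4 (int q)" by simp
  \<comment> \<open>Fourier inversion on the residues modulo \<open>q\<close>\<close>
  have inv: "of_int (Jacobi m q) = (\<Sum>b\<in>?I. gauss_sum q (- b) * add_char q (b * m)) / of_nat q" for m
  proof -
    have "(\<Sum>b\<in>?I. gauss_sum q (- b) * add_char q (b * m))
        = (\<Sum>c\<in>?I. of_int (Jacobi c q) * (\<Sum>b\<in>?I. add_char q (b * (m - c))))"
      unfolding gauss_sum_def sum_distrib_left sum_distrib_right
      by (subst sum.swap, intro sum.cong refl)
         (simp add: algebra_simps flip: add_char_add)
    also have "\<dots> = (\<Sum>c\<in>?I. if c = m mod int q then of_int (Jacobi c q) * of_nat q else 0)"
    proof (intro sum.cong refl)
      fix c assume "c \<in> ?I"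
      then have "int q dvd m - c \<longleftrightarrow> c = m mod int q"
        by (auto simp: mod_eq_dvd_iff[symmetric])
      then show "of_int (Jacobi c q) * (\<Sum>b\<in>?I. add_char q (b * (m - c)))
        = (if c = m mod int q then of_int (Jacobi c q) * of_nat q else 0)"
        by (simp add: add_char_orthogonality[OF q])
    qed
    also have "\<dots> = of_int (Jacobi (m mod int q) q) * of_nat q"
      using q by (simp add: sum.delta)
    also have "Jacobi (m mod int q) q = Jacobi m q" by (rule Jacobi_cong) auto
    finally show ?thesis using q by simp
  qed
  \<comment> \<open>the bound for the geometric sum; \<open>c = 0\<close> is harmless because its Gauss sum vanishes\<close>
  define H where "H c = (if c = 0 then 0 else (real q / 2) * (1 / of_int c + 1 / of_int (int q - c)))" for c
  have geo: "norm (\<Sum>j<J. add_char q (c * int j)) \<le> H (c mod int q)" if "\<not> int q dvd c" for c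
  proof -
    have "c mod int q \<noteq> 0" using that by (simp add: dvd_eq_mod_eq_0)
    moreover have "0 \<le> c mod int q" "c mod int q < int q" using q by simp_all
    ultimately have "norm (\<Sum>j<J. add_char q (c mod int q * int j)) \<le> H (c mod int q)"
      using norm_geometric_sum_add_char[of "c mod int q" q J] by (simp add: H_def)
    then show ?thesis by (simp add: add_char_mult_nat add_char_mod[OF q])
  qed
  have g0: "gauss_sum q 0 = 0"
    by (rule gauss_sum_not_coprime[OF assms(1,2)]) (use assms(3) in auto)
  have "complex_of_real (\<Sum>j<J. real_of_int (Jacobi (4 * int j + r) q))
      = (\<Sum>b\<in>?I. gauss_sum q (- b) * add_char q (b * r) * (\<Sum>j<J. add_char q ((4 * b) * int j))) / of_nat q"
    (is "complex_of_real ?S = ?R / _")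
    unfolding sum_distrib_left
    by (subst sum.swap) (simp add: inv sum_divide_distrib algebra_simps flip: add_char_add)
  then have "norm (complex_of_real ?S) = norm (?R / of_nat q)" by (rule arg_cong)
  then have "\<bar>?S\<bar> = norm ?R / q" 
    by (simp only: norm_of_real norm_divide norm_of_nat)
  also have "norm ?R \<le> (\<Sum>b\<in>?I. sqrt q * H (4 * b mod int q))"
  proof (rule sum_norm_le)
    fix b assume b: "b \<in> ?I"
    show "norm (gauss_sum q (- b) * add_char q (b * r) * (\<Sum>j<J. add_char q ((4 * b) * int j)))
        \<le> sqrt q * H (4 * b mod int q)"
    proof (cases "b = 0")
      case True
      then show ?thesis by (simp add: g0 H_def)
    next
      case False
      have "\<not> int q dvd b" using b False zdvd_imp_le[of "int q" b] by auto
      then have "\<not> int q dvd 4 * b"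
        using four by (simp add: coprime_dvd_mult_right_iff coprime_commute)
      then show ?thesis
        unfolding norm_mult norm_add_char mult_1_right
        by (intro mult_mono geo norm_gauss_sum_le assms) auto
    qed
  qed
  also have "(\<Sum>b\<in>?I. sqrt q * H (4 * b mod int q)) = sqrt q * (\<Sum>b\<in>?I. H (b mod int q))"
    unfolding sum_distrib_left[symmetric]
    by (subst sum_dilate_mod[OF q four, of "\<lambda>b. H (b mod int q)"]) (auto simp: cong_def)
  also have "(\<Sum>b\<in>?I. H (b mod int q)) = (\<Sum>b\<in>{1..<int q}. H b)"
    by (rule sum.mono_neutral_cong_right) (auto simp: H_def)
  also have "\<dots> = (real q / 2) * ((\<Sum>b\<in>{1..<int q}. 1 / of_int b) + (\<Sum>b\<in>{1..<int q}. 1 / of_int (int q - b)))"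
    by (simp add: H_def sum.distrib[symmetric] sum_distrib_left)
  also have "(\<Sum>b\<in>{1..<int q}. 1 / real_of_int (int q - b)) = (\<Sum>b\<in>{1..<int q}. 1 / of_int b)"
    by (rule sum.reindex_bij_witness[of _ "\<lambda>b. int q - b" "\<lambda>b. int q - b"]) auto
  also have "(\<Sum>b\<in>{1..<int q}. 1 / real_of_int b) = harm (q - 1)"
    unfolding harm_def
    by (rule sum.reindex_bij_witness[of _ int nat]) (auto simp: inverse_eq_divide)
  also have "sqrt q * (real q / 2 * (harm (q - 1) + harm (q - 1))) / q = sqrt q * harm (q - 1)"
    using q by simp
  also have "\<dots> \<le> sqrt q * (1 + ln q)"
    using harm_le_1_plus_ln[OF q] harm_mono[of "q - 1" q, where 'a = real]
    by (intro mult_left_mono) auto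
  finally show ?thesis using q by (simp add: divide_right_mono)
qed


text \<open>
Extending the symbol by zero to even \<open>m\<close> keeps it completely multiplicative in \<open>m\<close> and lets sums
run over full intervals.
\<close>

definition odd_Jacobi :: "nat \<Rightarrow> nat \<Rightarrow> real" where
  "odd_Jacobi n m = (if odd m then real_of_int (Jacobi (int n) m) else 0)"

lemma odd_Jacobi_mult_right:
  assumes "m > 0" "k > 0"
  shows "odd_Jacobi n (m * k) = odd_Jacobi n m * odd_Jacobi n k"
  using Jacobi_mult_right[OF assms, of "int n"] by (simp add: odd_Jacobi_def)

lemma odd_Jacobi_mult_left: "odd_Jacobi (a * b) m = odd_Jacobi a m * odd_Jacobi b m"
  using Jacobi_mult_left[of m "int a" "int b"] by (simp add: odd_Jacobi_def)

lemma abs_odd_Jacobi_le_1: "\<bar>odd_Jacobi n m\<bar> \<le> 1"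
  using Jacobi_values[of "int n" m] by (auto simp: odd_Jacobi_def)

lemma odd_Jacobi_square:
  assumes "m > 0"
  shows "odd_Jacobi (k ^ 2) m = (if odd m \<and> coprime k m then 1 else 0)"
  using Jacobi_values[of "int k" m] Jacobi_eq_0_iff[OF assms, of "int k"]
  by (auto simp: odd_Jacobi_mult_left power2_eq_square) (auto simp: odd_Jacobi_def)

lemma sum_multiples:
  fixes c :: "nat \<Rightarrow> 'a::comm_monoid_add"
  assumes "d > 0"
  shows "(\<Sum>m | m \<in> {1..x} \<and> d dvd m. c m) = (\<Sum>j\<in>{1..x div d}. c (d * j))"
proof (rule sum.reindex_bij_witness[of _ "\<lambda>j. d * j" "\<lambda>m. m div d"])
  fix m assume "m \<in> {m. m \<in> {1..x} \<and> d dvd m}"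
  then obtain j where "m = d * j" "m \<ge> 1" "m \<le> x" by auto
  then show "m div d \<in> {1..x div d}"
    using assms by (auto simp: less_eq_div_iff_mult_less_eq mult.commute intro: Suc_leI)
next
  fix j assume "j \<in> {1..x div d}"
  then show "d * j \<in> {m. m \<in> {1..x} \<and> d dvd m}"
    using assms by (auto simp: less_eq_div_iff_mult_less_eq mult.commute intro: Suc_leI)
qed (use assms in auto)

text \<open>
By reciprocity \<open>(q / m)\<close> is, up to a sign constant on each odd class modulo 4, the character
\<open>(m / q)\<close>; each class is an arithmetic progression.
\<close>

lemma Polya_Vinogradov_squarefree:
  assumes "squarefree q" "odd q" "q > 1"
  shows "\<bar>\<Sum>m\<in>{1..x}. odd_Jacobi q m\<bar> \<le> 2 * sqrt q * (1 + ln q)"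
proof -
  define s :: real where "s = (if q mod 4 = 3 then -1 else 1)"
  have e1: "odd_Jacobi q (4 * j + 1) = real_of_int (Jacobi (4 * int j + 1) q)" for j
    using Jacobi_reciprocity[OF _ assms(2), of "4 * j + 1"]
    by (simp add: odd_Jacobi_def mod_Suc add.commute)
  have e3: "odd_Jacobi q (4 * j + 3) = s * real_of_int (Jacobi (4 * int j + 3) q)" for j
    using Jacobi_reciprocity[OF _ assms(2), of "4 * j + 3"]
    by (simp add: odd_Jacobi_def s_def add.commute)
  have "(\<Sum>m\<in>{1..x}. odd_Jacobi q m) = (\<Sum>m\<in>{m\<in>{1..x}. m mod 4 = 1} \<union> {m\<in>{1..x}. m mod 4 = 3}. odd_Jacobi q m)"
  proof (rule sum.mono_neutral_right)
    show "\<forall>m\<in>{1..x} - ({m\<in>{1..x}. m mod 4 = 1} \<union> {m\<in>{1..x}. m mod 4 = 3}). odd_Jacobi q m = 0"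
    proof
      fix m assume "m \<in> {1..x} - ({m\<in>{1..x}. m mod 4 = 1} \<union> {m\<in>{1..x}. m mod 4 = 3})"
      then have "m mod 4 \<noteq> 1" "m mod 4 \<noteq> 3" by auto
      then have "even m" by presburger
      then show "odd_Jacobi q m = 0" by (simp add: odd_Jacobi_def)
    qed
  qed auto
  also have "\<dots> = (\<Sum>m\<in>{m\<in>{1..x}. m mod 4 = 1}. odd_Jacobi q m) + (\<Sum>m\<in>{m\<in>{1..x}. m mod 4 = 3}. odd_Jacobi q m)"
    by (rule sum.union_disjoint) auto
  also have "(\<Sum>m\<in>{m\<in>{1..x}. m mod 4 = 1}. odd_Jacobi q m) = (\<Sum>j<(x + 3) div 4. odd_Jacobi q (4 * j + 1))"
  proof (rule sum.reindex_bij_witness[of _ "\<lambda>j. 4 * j + 1" "\<lambda>m. m div 4"])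
    fix m assume m: "m \<in> {m\<in>{1..x}. m mod 4 = 1}"
    then show *: "4 * (m div 4) + 1 = m" using div_mult_mod_eq[of m 4] by simp
    have "Suc (m div 4) * 4 = (4 * (m div 4) + 1) + 3" by simp
    then have "Suc (m div 4) * 4 \<le> x + 3" unfolding * using m by simp
    then show "m div 4 \<in> {..<(x + 3) div 4}"
      using less_eq_div_iff_mult_less_eq[of 4 "Suc (m div 4)" "x + 3"] by simp
    show "odd_Jacobi q (4 * (m div 4) + 1) = odd_Jacobi q m" unfolding * ..
  next
    fix j assume j: "j \<in> {..<(x + 3) div 4}"
    show "(4 * j + 1) div 4 = j" by simp
    have "4 * j + 1 \<le> x"
      using j less_eq_div_iff_mult_less_eq[of 4 "Suc j" "x + 3"] by simp
    then show "4 * j + 1 \<in> {m\<in>{1..x}. m mod 4 = 1}" by (simp add: mod_Suc)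
  qed
  also have "(\<Sum>m\<in>{m\<in>{1..x}. m mod 4 = 3}. odd_Jacobi q m) = (\<Sum>j<(x + 1) div 4. odd_Jacobi q (4 * j + 3))"
  proof (rule sum.reindex_bij_witness[of _ "\<lambda>j. 4 * j + 3" "\<lambda>m. m div 4"])
    fix m assume m: "m \<in> {m\<in>{1..x}. m mod 4 = 3}"
    then show *: "4 * (m div 4) + 3 = m" using div_mult_mod_eq[of m 4] by simp
    have "Suc (m div 4) * 4 = (4 * (m div 4) + 3) + 1" by simp
    then have "Suc (m div 4) * 4 \<le> x + 1" unfolding * using m by simp
    then show "m div 4 \<in> {..<(x + 1) div 4}"
      using less_eq_div_iff_mult_less_eq[of 4 "Suc (m div 4)" "x + 1"] by simp
    show "odd_Jacobi q (4 * (m div 4) + 3) = odd_Jacobi q m" unfolding * ..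
  next
    fix j assume j: "j \<in> {..<(x + 1) div 4}"
    show "(4 * j + 3) div 4 = j" by simp
    have "4 * j + 3 \<le> x"
      using j less_eq_div_iff_mult_less_eq[of 4 "Suc j" "x + 1"] by simp
    then show "4 * j + 3 \<in> {m\<in>{1..x}. m mod 4 = 3}" by simp
  qed
  also have "\<bar>(\<Sum>j<(x + 3) div 4. odd_Jacobi q (4 * j + 1)) + (\<Sum>j<(x + 1) div 4. odd_Jacobi q (4 * j + 3))\<bar>
     \<le> sqrt q * (1 + ln q) + sqrt q * (1 + ln q)"
    unfolding e1 e3 sum_distrib_left[symmetric]
    by (intro order.trans[OF abs_triangle_ineq] add_mono Jacobi_progression_sum assms)
       (use Jacobi_progression_sum[OF assms] in \<open>simp add: abs_mult s_def\<close>)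
  finally show ?thesis by simp
qed

text \<open>
A factor \<open>p\<^sup>2\<close> in the upper entry only removes the multiples of \<open>p\<close>. By complete multiplicativity
these form a shorter sum of the same shape, so each prime of \<open>k\<close> at most doubles the bound, and
\<open>2 \<le> p\<close>.
\<close>

lemma odd_Jacobi_square_multiple_sum:
  assumes B: "\<And>x. \<bar>\<Sum>m\<in>{1..x}. odd_Jacobi q m\<bar> \<le> B"
  shows "k > 0 \<Longrightarrow> \<bar>\<Sum>m\<in>{1..x}. odd_Jacobi (q * k ^ 2) m\<bar> \<le> real k * B"
proof (induction k arbitrary: x rule: prime_divisors_induct)
  case zero
  then show ?case by simp
next
  case (unit k)
  then show ?case using B by simp
next
  case (factor p k)
  have B0: "B \<ge> 0" using B[of 0] by simp
  have p: "p > 0" "p \<ge> 2" using factor(1) prime_ge_2_nat by (auto intro: prime_gt_0_nat)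
  have k: "k > 0" using factor.prems by simp
  let ?c = "odd_Jacobi (q * k ^ 2)"
  have "(\<Sum>m\<in>{1..x}. odd_Jacobi (q * (p * k) ^ 2) m) = (\<Sum>m\<in>{1..x}. ?c m - (if p dvd m then ?c m else 0))"
  proof (rule sum.cong[OF refl])
    fix m assume m: "m \<in> {1..x}"
    have "odd_Jacobi (q * (p * k) ^ 2) m = ?c m * odd_Jacobi (p ^ 2) m"
      by (simp add: power_mult_distrib odd_Jacobi_mult_left mult_ac)
    also have "odd_Jacobi (p ^ 2) m = (if odd m \<and> \<not> p dvd m then 1 else 0)"
      using m odd_Jacobi_square[of m p] prime_imp_coprime[OF factor(1), of m] not_prime_unit[of p] factor(1)
      by (auto simp: coprime_absorb_left)
    finally show "odd_Jacobi (q * (p * k) ^ 2) m = ?c m - (if p dvd m then ?c m else 0)"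
      by (auto simp: odd_Jacobi_def)
  qed
  also have "\<dots> = (\<Sum>m\<in>{1..x}. ?c m) - (\<Sum>m | m \<in> {1..x} \<and> p dvd m. ?c m)"
    by (simp add: sum_subtractf sum.inter_filter[symmetric])
  also have "(\<Sum>m | m \<in> {1..x} \<and> p dvd m. ?c m) = ?c p * (\<Sum>j\<in>{1..x div p}. ?c j)"
    unfolding sum_multiples[OF p(1)] sum_distrib_left
    by (intro sum.cong refl odd_Jacobi_mult_right p) auto
  also have "\<bar>(\<Sum>m\<in>{1..x}. ?c m) - ?c p * (\<Sum>j\<in>{1..x div p}. ?c j)\<bar> \<le> real k * B + 1 * (real k * B)"
    by (intro order.trans[OF abs_triangle_ineq4] add_mono factor.IH k)
       (unfold abs_mult, intro mult_mono factor.IH k abs_odd_Jacobi_le_1, auto)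
  also have "\<dots> = 2 * (real k * B)" by simp
  also have "\<dots> \<le> real p * (real k * B)"
    using p B0 by (intro mult_right_mono) auto
  finally show ?case by (simp add: mult_ac)
qed

text \<open>
Write \<open>n = q k\<^sup>2\<close> with \<open>q > 1\<close> squarefree. The loss \<open>k\<close> from the square part is exactly absorbed by
\<open>sqrt q * k = sqrt n\<close>.
\<close>

lemma Polya_Vinogradov:
  assumes "odd n" "\<not> is_nth_power 2 n"
  shows "\<bar>\<Sum>m\<in>{1..x}. odd_Jacobi n m\<bar> \<le> 2 * sqrt n * (1 + ln n)"
proof -
  define q k where "q = squarefree_part n" and "k = square_part n"
  have n: "n = q * k ^ 2" unfolding q_def k_def by (rule squarefree_decompose)
  have n0: "n > 0" using assms(1) by (rule odd_pos)
  have "q dvd n" by (subst n) simp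
  then have q: "squarefree q" "odd q" using assms(1) dvd_trans[of 2 q n] by (auto simp: q_def)
  have "q \<noteq> 1" using assms(2) n by auto
  moreover have "q > 0" using q(2) by (rule odd_pos)
  ultimately have q1: "q > 1" by linarith
  have k0: "k > 0" using n n0 by (cases k) auto
  have "\<bar>\<Sum>m\<in>{1..x}. odd_Jacobi n m\<bar> \<le> real k * (2 * sqrt q * (1 + ln q))"
    unfolding n by (rule odd_Jacobi_square_multiple_sum[OF Polya_Vinogradov_squarefree[OF q q1] k0])
  also have "\<dots> = 2 * sqrt n * (1 + ln q)"
    by (simp add: n real_sqrt_mult)
  also have "\<dots> \<le> 2 * sqrt n * (1 + ln n)"
  proof -
    have "q \<le> n" using n0 by (intro dvd_imp_le) (auto simp: n)
    then show ?thesis using q1 by (intro mult_left_mono add_left_mono) auto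
  qed
  finally show ?thesis .
qed

section \<open>Rankin's lower bound for the mass of the Selberg sieve\<close>

lemma sum_ln_prime_factors_le:
  assumes "m > 0"
  shows "(\<Sum>p\<in>prime_factors m. ln (real p)) \<le> ln (real m)"
proof -
  have pos: "p > 0" if "p \<in> prime_factors m" for p
    using that prime_gt_0_nat by auto
  have "(\<Prod>p\<in>prime_factors m. p) \<le> (\<Prod>p\<in>prime_factors m. p ^ multiplicity p m)"
  proof (rule prod_mono)
    fix p assume p: "p \<in> prime_factors m"
    then have "multiplicity p m \<ge> 1"
      using assms by (simp add: prime_factors_multiplicity Suc_le_eq)
    then show "0 \<le> p \<and> p \<le> p ^ multiplicity p m"
      using pos[OF p] by (simp add: self_le_power)
  qed
  also have "\<dots> = m" using prod_prime_factors[of m] assms by simp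
  finally have "real (\<Prod>p\<in>prime_factors m. p) \<le> real m" by linarith
  moreover have "(\<Sum>p\<in>prime_factors m. ln (real p)) = ln (real (\<Prod>p\<in>prime_factors m. p))"
    using pos by (simp add: ln_prod)
  ultimately show ?thesis
    using pos assms by (simp add: prod_pos)
qed

text \<open>
Chebyshev's double count of \<open>log n!\<close>: each \<open>m \<le> n\<close> has \<open>\<Sum> log p \<le> log m\<close> over its prime factors, whereas each
\<open>p \<le> n\<close> divides at least \<open>n / (2 p)\<close> of these \<open>m\<close>.
\<close>

lemma sum_ln_over_primes_le:
  assumes "finite P" "\<And>p. p \<in> P \<Longrightarrow> prime p \<and> p \<le> n" "n \<ge> 1"
  shows "(\<Sum>p\<in>P. ln (real p) / real p) \<le> 2 * ln (real n)"
proof -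
  have P: "prime p" "p \<le> n" "p > 0" if "p \<in> P" for p
    using assms(2)[OF that] prime_gt_0_nat by auto
  have "(real n / 2) * (\<Sum>p\<in>P. ln (real p) / real p) = (\<Sum>p\<in>P. ln (real p) * (real n / (2 * real p)))"
    by (simp add: sum_distrib_left algebra_simps)
  also have "\<dots> \<le> (\<Sum>p\<in>P. ln (real p) * real (n div p))"
  proof (intro sum_mono mult_left_mono)
    fix p assume p: "p \<in> P"
    have "n div p \<ge> 1" using P[OF p] by (simp add: div_greater_zero_iff Suc_le_eq)
    moreover have "n < p * (n div p + 1)"
      using P(3)[OF p] by (metis dividend_less_times_div mult_Suc_right Suc_eq_plus1 add.commute)
    moreover have "p * 1 \<le> p * (n div p)" by (rule mult_le_mono2) fact
    moreover have "2 * p * (n div p) = p * (n div p) + p * (n div p)" "p * (n div p + 1) = p * (n div p) + p * 1"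
      by (simp_all add: algebra_simps)
    ultimately have "n \<le> 2 * p * (n div p)" by linarith
    then have "real n \<le> 2 * real p * real (n div p)"
      by (metis of_nat_le_iff of_nat_mult of_nat_numeral)
    then show "real n / (2 * real p) \<le> real (n div p)"
      using P(3)[OF p] by (simp add: divide_simps mult_ac)
    show "ln (real p) \<ge> 0" using P(3)[OF p] by simp
  qed
  also have "\<dots> = (\<Sum>p\<in>P. \<Sum>m\<in>{1..n}. if p dvd m then ln (real p) else 0)"
  proof (intro sum.cong refl)
    fix p assume p: "p \<in> P"
    have "(\<Sum>m\<in>{1..n}. if p dvd m then ln (real p) else 0) = (\<Sum>m | m \<in> {1..n} \<and> p dvd m. ln (real p))"
      by (simp add: sum.inter_filter[symmetric])
    also have "\<dots> = real (n div p) * ln (real p)"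
      by (subst sum_multiples[OF P(3)[OF p]]) simp
    finally show "ln (real p) * real (n div p) = (\<Sum>m\<in>{1..n}. if p dvd m then ln (real p) else 0)"
      by simp
  qed
  also have "\<dots> = (\<Sum>m\<in>{1..n}. \<Sum>p | p \<in> P \<and> p dvd m. ln (real p))"
    by (subst sum.swap) (simp add: sum.inter_filter[OF assms(1)])
  also have "\<dots> \<le> (\<Sum>m\<in>{1..n}. ln (real n))"
  proof (rule sum_mono)
    fix m assume m: "m \<in> {1..n}"
    have "(\<Sum>p | p \<in> P \<and> p dvd m. ln (real p)) \<le> (\<Sum>p\<in>prime_factors m. ln (real p))"
      using m P prime_gt_0_nat by (intro sum_mono2) (auto simp: in_prime_factors_iff Suc_le_eq)
    also have "\<dots> \<le> ln (real m)" by (rule sum_ln_prime_factors_le) (use m in auto)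
    also have "\<dots> \<le> ln (real n)" using m by simp
    finally show "(\<Sum>p | p \<in> P \<and> p dvd m. ln (real p)) \<le> ln (real n)" .
  qed
  finally have "(real n / 2) * (\<Sum>p\<in>P. ln (real p) / real p) \<le> (real n / 2) * (2 * ln (real n))"
    by simp
  then show ?thesis using assms(3) by (simp add: mult_le_cancel_left)
qed

text \<open>
A squarefree divisor \<open>d\<close> is represented by its set \<open>S\<close> of prime factors. Then gcd and lcm become
intersection and union, and divisor sums become expansions of products over subsets.
\<close>

definition sieve_support :: "nat set \<Rightarrow> real \<Rightarrow> nat set set" where
  "sieve_support P R = {S. S \<subseteq> P \<and> real (\<Prod>S) \<le> R}"

text \<open>
The sum of \<open>1 / \<phi>(d)\<close> over squarefree \<open>d \<le> R\<close> composed of primes in \<open>P\<close>.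
\<close>

definition sieve_mass :: "nat set \<Rightarrow> real \<Rightarrow> real" where
  "sieve_mass P R = (\<Sum>S\<in>sieve_support P R. \<Prod>p\<in>S. 1 / (real p - 1))"

lemma finite_sieve_support: "finite P \<Longrightarrow> finite (sieve_support P R)"
  unfolding sieve_support_def by (rule finite_subset[of _ "Pow P"]) auto

lemma exp_le_1_plus_2x:
  assumes "0 \<le> x" "x \<le> (1::real)"
  shows "exp x \<le> 1 + 2 * x"
proof -
  have "x\<^sup>2 \<le> x" using assms by (simp add: power2_eq_square mult_left_le)
  then show ?thesis using exp_bound[OF assms] by linarith
qed

text \<open>
Without the restriction \<open>d \<le> R\<close> the mass would be the Euler product \<open>1 / V\<close>. Rankin's trick
bounds the tail: with \<open>s = 1 / log z\<close> the weight \<open>(d / R) powr s\<close> is at least 1 for \<open>d \<ge> R = z\<^sup>5\<close>, and inserting it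
costs a factor \<open>exp 4\<close> in the Euler product but gains \<open>R powr (-s) = exp (-5)\<close>. So the tail is at most half of the
whole, uniformly in \<open>P\<close>.
\<close>

lemma sieve_mass_ge:
  assumes P: "finite P" "\<And>p. p \<in> P \<Longrightarrow> prime p \<and> real p \<le> z" and z: "z > 1"
  shows "sieve_mass P (z ^ 5) \<ge> 1 / (2 * (\<Prod>p\<in>P. 1 - 1 / real p))"
proof -
  define s where "s = 1 / ln z"
  define E where "E = (\<Prod>p\<in>P. real p / (real p - 1))"
  have lnz: "ln z > 0" using z by simp
  have s: "s > 0" using lnz by (simp add: s_def)
  have p2: "real p \<ge> 2" if "p \<in> P" for p
    using P(2)[OF that] prime_ge_2_nat[of p] by auto
  have E: "E > 0" unfolding E_def by (intro prod_pos) (use p2 in fastforce)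
  have E_inv: "1 / (\<Prod>p\<in>P. 1 - 1 / real p) = E"
    unfolding E_def prod_dividef[symmetric, of "\<lambda>_. 1", simplified]
    by (intro prod.cong refl) (use p2 in \<open>force simp: divide_simps\<close>)
  have sp: "s * ln (real p) \<le> 1" "s * ln (real p) \<ge> 0" if "p \<in> P" for p
    using P(2)[OF that] p2[OF that] lnz z s by (auto simp: s_def)
  have "(\<Sum>p\<in>P. ln (real p) / real p) \<le> 2 * ln (real (nat \<lfloor>z\<rfloor>))"
    by (rule sum_ln_over_primes_le) (use P z in \<open>auto simp: le_nat_floor\<close>)
  also have "\<dots> \<le> 2 * ln z" using z by simp
  finally have mert: "(\<Sum>p\<in>P. ln (real p) / real p) \<le> 2 * ln z" .
  have tail: "(\<Sum>S\<in>Pow P. \<Prod>p\<in>S. real p powr s / (real p - 1)) \<le> E * exp 4"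
  proof -
    have "(\<Sum>S\<in>Pow P. \<Prod>p\<in>S. real p powr s / (real p - 1)) = (\<Prod>p\<in>P. real p powr s / (real p - 1) + 1)"
      by (simp add: prod_add[OF P(1)])
    also have "\<dots> \<le> (\<Prod>p\<in>P. (real p / (real p - 1)) * exp (2 * s * (ln (real p) / real p)))"
    proof (rule prod_mono)
      fix p assume p: "p \<in> P"
      note p2 = p2[OF p]
      have "real p powr s = exp (s * ln (real p))" using p2 by (simp add: powr_def)
      also have "\<dots> \<le> 1 + 2 * (s * ln (real p))" by (rule exp_le_1_plus_2x) (use sp[OF p] in auto)
      finally have "real p powr s / (real p - 1) + 1 \<le> (1 + 2 * (s * ln (real p))) / (real p - 1) + 1"
        using p2 by (intro add_right_mono divide_right_mono) auto
      also have "\<dots> = (real p / (real p - 1)) * (1 + 2 * s * (ln (real p) / real p))"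
        using p2 by (simp add: divide_simps)
      also have "\<dots> \<le> (real p / (real p - 1)) * exp (2 * s * (ln (real p) / real p))"
        using p2 by (intro mult_left_mono exp_ge_add_one_self) auto
      finally show "0 \<le> real p powr s / (real p - 1) + 1 \<and>
          real p powr s / (real p - 1) + 1 \<le> (real p / (real p - 1)) * exp (2 * s * (ln (real p) / real p))"
        using p2 by auto
    qed
    also have "\<dots> = E * exp (2 * s * (\<Sum>p\<in>P. ln (real p) / real p))"
      unfolding E_def prod.distrib sum_distrib_left exp_sum[OF P(1)] by simp
    also have "\<dots> \<le> E * exp (2 * s * (2 * ln z))"
      using mert s E by (intro mult_left_mono) (auto intro: mult_left_mono)
    also have "2 * s * (2 * ln z) = 4" using lnz by (simp add: s_def)
    finally show ?thesis .
  qed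
  have R: "(z ^ 5) powr (- s) = exp (- 5)"
    using z lnz by (simp add: powr_def ln_realpow s_def)
  have "E - exp (- 5) * (E * exp 4) \<le> (\<Prod>p\<in>P. 1 / (real p - 1) + 1) - (z ^ 5) powr (- s) * (\<Sum>S\<in>Pow P. \<Prod>p\<in>S. real p powr s / (real p - 1))"
  proof (rule diff_mono)
    show "E \<le> (\<Prod>p\<in>P. 1 / (real p - 1) + 1)"
      unfolding E_def by (intro eq_refl prod.cong refl) (use p2 in \<open>force simp: divide_simps\<close>)
    show "(z ^ 5) powr (- s) * (\<Sum>S\<in>Pow P. \<Prod>p\<in>S. real p powr s / (real p - 1)) \<le> exp (- 5) * (E * exp 4)"
      unfolding R using tail by (intro mult_left_mono) auto
  qed
  also have "(\<Prod>p\<in>P. 1 / (real p - 1) + 1) = (\<Sum>S\<in>Pow P. \<Prod>p\<in>S. 1 / (real p - 1))"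
    by (simp add: prod_add[OF P(1)])
  also have "\<dots> - (z ^ 5) powr (- s) * (\<Sum>S\<in>Pow P. \<Prod>p\<in>S. real p powr s / (real p - 1))
     = (\<Sum>S\<in>Pow P. (1 - (z ^ 5) powr (- s) * (\<Prod>p\<in>S. real p powr s)) * (\<Prod>p\<in>S. 1 / (real p - 1)))"
    by (simp add: sum_distrib_left sum_subtractf[symmetric] prod_dividef diff_divide_distrib)
  also have "\<dots> \<le> (\<Sum>S\<in>Pow P. if S \<in> sieve_support P (z ^ 5) then (\<Prod>p\<in>S. 1 / (real p - 1)) else 0)"
  proof (rule sum_mono)
    fix S assume S: "S \<in> Pow P"
    have w: "(\<Prod>p\<in>S. 1 / (real p - 1)) \<ge> 0" using S p2 by (intro prod_nonneg) fastforce
    have pw: "(\<Prod>p\<in>S. real p powr s) = real (\<Prod>S) powr s"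
      by (simp add: prod_powr_distrib)
    show "(1 - (z ^ 5) powr (- s) * (\<Prod>p\<in>S. real p powr s)) * (\<Prod>p\<in>S. 1 / (real p - 1))
      \<le> (if S \<in> sieve_support P (z ^ 5) then (\<Prod>p\<in>S. 1 / (real p - 1)) else 0)"
    proof (cases "S \<in> sieve_support P (z ^ 5)")
      case True
      have "(1 - (z ^ 5) powr (- s) * (\<Prod>p\<in>S. real p powr s)) \<le> 1"
        unfolding pw by simp
      then have "(1 - (z ^ 5) powr (- s) * (\<Prod>p\<in>S. real p powr s)) * (\<Prod>p\<in>S. 1 / (real p - 1)) \<le> 1 * (\<Prod>p\<in>S. 1 / (real p - 1))"
        by (rule mult_right_mono[OF _ w])
      then show ?thesis using True by simp
    next
      case False
      then have "z ^ 5 \<le> real (\<Prod>S)" using S by (simp add: sieve_support_def)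
      then have "(z ^ 5) powr s \<le> real (\<Prod>S) powr s"
        using s z by (intro powr_mono2) auto
      then have "1 \<le> (z ^ 5) powr (- s) * real (\<Prod>S) powr s"
        using z by (simp add: powr_minus divide_simps)
      then have "(1 - (z ^ 5) powr (- s) * (\<Prod>p\<in>S. real p powr s)) * (\<Prod>p\<in>S. 1 / (real p - 1)) \<le> 0"
        unfolding pw by (intro mult_nonpos_nonneg w) auto
      then show ?thesis using False by simp
    qed
  qed
  also have "\<dots> = sieve_mass P (z ^ 5)"
    unfolding sieve_mass_def using P(1)
    by (subst sum.inter_restrict[symmetric]) (auto simp: sieve_support_def intro!: sum.cong)
  finally have "E - exp (- 5) * (E * exp 4) \<le> sieve_mass P (z ^ 5)" .
  moreover have "exp (- 5) * (E * exp 4) \<le> E / 2"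
  proof -
    have "exp (- 5) * exp 4 = exp (- 1 :: real)" by (simp flip: exp_add)
    also have "\<dots> \<le> 1 / 2"
      using exp_ge_add_one_self[of 1] by (simp add: exp_minus field_simps)
    finally have "E * (exp (- 5) * exp 4) \<le> E * (1 / 2)" using E by (intro mult_left_mono) auto
    then show ?thesis by (simp add: mult_ac)
  qed
  ultimately have "E / 2 \<le> sieve_mass P (z ^ 5)" by linarith
  then show ?thesis unfolding E_inv[symmetric] by simp
qed

section \<open>Selberg weights and the sieve majorant\<close>

text \<open>
The point at which the diagonalised quadratic form \<open>\<Sum> \<phi>(k) y(k)\<^sup>2\<close> is minimal on the
hyperplane \<open>\<Sum> y(k) = 1\<close>, which is the normalisation \<open>\<lambda>(1) = 1\<close>. The signs \<open>\<mu>(k)\<close> are kept out of it.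
\<close>

definition sieve_y :: "nat set \<Rightarrow> real \<Rightarrow> nat set \<Rightarrow> real" where
  "sieve_y P R S = (\<Prod>p\<in>S. 1 / (real p - 1)) / sieve_mass P R"

text \<open>
Selberg's \<open>\<lambda>(d)\<close>, recovered from the diagonal coordinates by Moebius inversion.
\<close>

definition sieve_lambda :: "nat set \<Rightarrow> real \<Rightarrow> nat set \<Rightarrow> real" where
  "sieve_lambda P R S = (-1) ^ card S * real (\<Prod>S) * (\<Sum>T | T \<in> sieve_support P R \<and> S \<subseteq> T. sieve_y P R T)"

text \<open>
Moebius inversion on the Boolean lattice of subsets.
\<close>

lemma sum_alternating_between:
  assumes "finite T"
  shows "(\<Sum>S | K \<subseteq> S \<and> S \<subseteq> T. (-1::real) ^ card S) = (if K = T then (-1) ^ card K else 0)"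
proof (cases "K \<subseteq> T")
  case True
  then have "finite K" using assms finite_subset by blast
  have "(\<Sum>S | K \<subseteq> S \<and> S \<subseteq> T. (-1::real) ^ card S) = (\<Sum>U\<in>Pow (T - K). (-1) ^ card (K \<union> U))"
    by (rule sum.reindex_bij_witness[of _ "\<lambda>U. K \<union> U" "\<lambda>S. S - K"]) (use True in \<open>auto simp: Un_absorb1\<close>)
  also have "\<dots> = (\<Sum>U\<in>Pow (T - K). (-1) ^ card K * (-1) ^ card U)"
    using \<open>finite K\<close> assms
    by (intro sum.cong refl, subst card_Un_disjoint) (auto simp: power_add intro: finite_subset)
  also have "\<dots> = (-1) ^ card K * (\<Prod>x\<in>T - K. -1 + 1)"
    using assms by (subst prod_add) (auto simp: sum_distrib_left)
  also have "\<dots> = (if K = T then (-1) ^ card K else 0)"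
    using True assms by (auto simp: prod_zero_iff)
  finally show ?thesis .
next
  case False
  then have empty: "{S. K \<subseteq> S \<and> S \<subseteq> T} = {}" and "K \<noteq> T" by auto
  show ?thesis unfolding empty using \<open>K \<noteq> T\<close> by simp
qed

context
  fixes P :: "nat set" and R :: real
  assumes finP: "finite P" and primeP: "\<And>p. p \<in> P \<Longrightarrow> prime p" and R: "R \<ge> 1"
begin

lemma P_ge_2: "p \<in> P \<Longrightarrow> real p \<ge> 2"
  using primeP[of p] prime_ge_2_nat[of p] by auto

lemma sieve_support_subset: "S \<in> sieve_support P R \<Longrightarrow> S \<subseteq> P"
  by (simp add: sieve_support_def)

lemma empty_in_sieve_support: "{} \<in> sieve_support P R"
  using R by (simp add: sieve_support_def)

lemma prod_P_pos: "S \<subseteq> P \<Longrightarrow> \<Prod>S > 0"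
  using P_ge_2 by (intro prod_pos) force

lemma sieve_support_down:
  assumes "T \<in> sieve_support P R" "S \<subseteq> T"
  shows "S \<in> sieve_support P R"
proof -
  have T: "T \<subseteq> P" "finite T" using assms(1) finP finite_subset by (auto simp: sieve_support_def)
  have "\<Prod>S dvd \<Prod>T" using T(2) assms(2) by (rule prod_dvd_prod_subset)
  then have "\<Prod>S \<le> \<Prod>T" by (rule dvd_imp_le) (rule prod_P_pos[OF T(1)])
  then have "real (\<Prod>S) \<le> real (\<Prod>T)" by (simp only: of_nat_le_iff)
  then show ?thesis using assms T by (auto simp: sieve_support_def simp del: of_nat_prod)
qed

lemma sieve_weight_pos: "S \<subseteq> P \<Longrightarrow> (\<Prod>p\<in>S. 1 / (real p - 1)) > 0"
  using P_ge_2 by (intro prod_pos) fastforce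

lemma sieve_mass_pos: "sieve_mass P R > 0"
  unfolding sieve_mass_def
  using empty_in_sieve_support sieve_weight_pos sieve_support_subset finite_sieve_support[OF finP]
  by (intro sum_pos) auto

lemma sieve_y_nonneg: "S \<in> sieve_support P R \<Longrightarrow> sieve_y P R S \<ge> 0"
  using sieve_weight_pos[of S] sieve_mass_pos sieve_support_subset[of S]
  by (simp add: sieve_y_def del: prod_dividef)

lemma sum_sieve_y: "(\<Sum>T\<in>sieve_support P R. sieve_y P R T) = 1"
  using sieve_mass_pos by (simp add: sieve_y_def sum_divide_distrib[symmetric] flip: sieve_mass_def)

lemma sieve_lambda_empty: "sieve_lambda P R {} = 1"
  by (simp add: sieve_lambda_def sum_sieve_y)

text \<open>
Selberg's weights satisfy \<open>\<bar>\<lambda>\<bar> \<le> 1\<close>, but the trivial bound by the level is good enough: it only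
raises the power of the level in the error terms.
\<close>

lemma abs_sieve_lambda_le:
  assumes "S \<in> sieve_support P R"
  shows "\<bar>sieve_lambda P R S\<bar> \<le> R"
proof -
  let ?s = "\<Sum>T | T \<in> sieve_support P R \<and> S \<subseteq> T. sieve_y P R T"
  have "?s \<ge> 0" by (intro sum_nonneg sieve_y_nonneg) auto
  have "?s \<le> (\<Sum>T\<in>sieve_support P R. sieve_y P R T)"
    by (intro sum_mono2 sieve_y_nonneg finite_sieve_support finP) auto
  then have "?s \<le> 1" by (simp add: sum_sieve_y)
  have "\<bar>sieve_lambda P R S\<bar> = real (\<Prod>S) * ?s"
    using \<open>?s \<ge> 0\<close> by (simp add: sieve_lambda_def abs_mult power_abs del: of_nat_prod)
  also have "\<dots> \<le> R * 1"
    using assms R \<open>?s \<ge> 0\<close> \<open>?s \<le> 1\<close> by (intro mult_mono) (auto simp: sieve_support_def)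
  finally show ?thesis by simp
qed

lemma prime_dvd_prod_P:
  assumes "S \<subseteq> P" "prime p" "p dvd \<Prod>S"
  shows "p \<in> S"
proof -
  have "finite S" using assms(1) finP finite_subset by blast
  then obtain r where "r \<in> S" "p dvd r" using prime_dvd_prod_iff[of S p id] assms by auto
  moreover have "prime r" using \<open>r \<in> S\<close> assms(1) primeP by auto
  ultimately show ?thesis using primes_dvd_imp_eq[of p r] assms(2) by blast
qed

lemma prod_P_dvd_iff:
  assumes "S \<subseteq> P"
  shows "\<Prod>S dvd m \<longleftrightarrow> (\<forall>p\<in>S. p dvd m)"
proof
  have finS: "finite S" using assms finP finite_subset by blast
  show "\<forall>p\<in>S. p dvd m" if "\<Prod>S dvd m"
    using that finS dvd_prodI[of S _ id] by (auto intro: dvd_trans)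
  show "\<Prod>S dvd m" if "\<forall>p\<in>S. p dvd m"
    using finS assms that
  proof (induction S rule: finite_induct)
    case (insert p S)
    have "coprime p (\<Prod>S)"
      using insert primeP prime_dvd_prod_P[of S p] prime_imp_coprime[of p "\<Prod>S"] by auto
    then show ?case using insert by (simp add: divides_mult)
  qed simp
qed

text \<open>
Distinct sets of primes have distinct products by unique factorisation.
\<close>

lemma card_sieve_support_le: "real (card (sieve_support P R)) \<le> R"
proof -
  have "inj_on (\<lambda>S. \<Prod>S) (sieve_support P R)"
  proof (rule inj_onI)
    fix S T assume ST: "S \<in> sieve_support P R" "T \<in> sieve_support P R" "\<Prod>S = \<Prod>T"
    have sub: "S \<subseteq> T" if "S \<subseteq> P" "T \<subseteq> P" "\<Prod>S = \<Prod>T" for S T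
    proof
      fix p assume "p \<in> S"
      moreover from this have "p dvd \<Prod>S" using prod_P_dvd_iff[OF that(1), of "\<Prod>S"] by simp
      ultimately show "p \<in> T" using that primeP prime_dvd_prod_P[of T p] by auto
    qed
    show "S = T" using sub[of S T] sub[of T S] ST sieve_support_subset by auto
  qed
  moreover have "(\<lambda>S. \<Prod>S) ` sieve_support P R \<subseteq> {1..nat \<lfloor>R\<rfloor>}"
  proof safe
    fix S assume S: "S \<in> sieve_support P R"
    then have "real (\<Prod>S) \<le> R" by (simp only: sieve_support_def mem_Collect_eq)
    then show "\<Prod>S \<in> {1..nat \<lfloor>R\<rfloor>}"
      using prod_P_pos[OF sieve_support_subset[OF S]] by (simp add: le_nat_floor Suc_le_eq del: of_nat_prod)
  qed
  ultimately have "card (sieve_support P R) \<le> card {1..nat \<lfloor>R\<rfloor>}"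
    by (metis card_image card_mono finite_atLeastAtMost)
  then show ?thesis using R by (simp add: le_nat_iff le_floor_iff)
qed

text \<open>
The kernel \<open>1 / lcm = gcd / (d e)\<close> is diagonalised by expanding \<open>gcd = \<Sum> \<phi>(k)\<close> over the common divisors \<open>k\<close>;
in the set language this is the expansion of \<open>\<Prod> ((p - 1) + 1)\<close> over subsets. Moebius inversion
identifies the new coordinates as \<open>\<plusminus> y(k)\<close>, and the choice of \<open>y\<close> makes each term of \<open>\<Sum> \<phi>(k) y(k)\<^sup>2\<close> proportional to
\<open>y(k)\<close>.
\<close>

lemma sieve_quadratic_form:
  "(\<Sum>S\<in>sieve_support P R. \<Sum>T\<in>sieve_support P R.
      sieve_lambda P R S * sieve_lambda P R T / real (\<Prod>(S \<union> T))) = 1 / sieve_mass P R"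
proof -
  let ?D = "sieve_support P R"
  define w where "w K = (\<Prod>p\<in>K. real p - 1)" for K :: "nat set"
  define mu where "mu S = (-1) ^ card S * (\<Sum>T | T \<in> ?D \<and> S \<subseteq> T. sieve_y P R T)" for S :: "nat set"
  have finD: "finite ?D" by (rule finite_sieve_support[OF finP])
  have fin: "finite S" if "S \<in> ?D" for S
    using that finP finite_subset sieve_support_subset by blast
  have w: "w K * sieve_y P R K = 1 / sieve_mass P R" if "K \<in> ?D" for K
  proof -
    have "w K * (\<Prod>p\<in>K. 1 / (real p - 1)) = (\<Prod>p\<in>K. 1)"
      unfolding w_def prod.distrib[symmetric]
      by (intro prod.cong refl) (use that sieve_support_subset P_ge_2 in force)
    then show ?thesis by (simp add: sieve_y_def del: prod_dividef)
  qed
  have summand: "sieve_lambda P R S * sieve_lambda P R T / real (\<Prod>(S \<union> T))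
      = (\<Sum>K\<in>?D. w K * ((if K \<subseteq> S then mu S else 0) * (if K \<subseteq> T then mu T else 0)))"
    if S: "S \<in> ?D" and T: "T \<in> ?D" for S T
  proof -
    have pos: "real (\<Prod>X) > 0" if "X \<subseteq> P" for X
      using prod_P_pos[OF that] by (simp only: of_nat_0_less_iff)
    have sub: "S \<subseteq> P" "T \<subseteq> P" using S T sieve_support_subset by auto
    have "\<Prod>(S \<union> T) * \<Prod>(S \<inter> T) = \<Prod>S * \<Prod>T"
      using prod.union_inter[OF fin[OF S] fin[OF T]] .
    then have ui: "real (\<Prod>(S \<union> T)) * real (\<Prod>(S \<inter> T)) = real (\<Prod>S) * real (\<Prod>T)"
      by (simp only: of_nat_mult[symmetric])
    have "sieve_lambda P R S * sieve_lambda P R T / real (\<Prod>(S \<union> T))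
        = mu S * mu T * (real (\<Prod>S) * real (\<Prod>T)) / real (\<Prod>(S \<union> T))"
      by (simp add: sieve_lambda_def mu_def del: of_nat_prod)
    also have "\<dots> = mu S * mu T * real (\<Prod>(S \<inter> T))"
      unfolding ui[symmetric] using pos[of "S \<union> T"] sub by (simp del: of_nat_prod)
    also have "real (\<Prod>(S \<inter> T)) = (\<Prod>p\<in>S \<inter> T. (real p - 1) + 1)" by simp
    also have "\<dots> = (\<Sum>K\<in>Pow (S \<inter> T). w K)"
      using fin[OF S] by (subst prod_add) (auto simp: w_def)
    also have "\<dots> = (\<Sum>K\<in>?D. if K \<subseteq> S \<and> K \<subseteq> T then w K else 0)"
      using sieve_support_down[OF S] finD
      by (intro sum.mono_neutral_cong_left) auto
    also have "mu S * mu T * \<dots> = (\<Sum>K\<in>?D. w K * ((if K \<subseteq> S then mu S else 0) * (if K \<subseteq> T then mu T else 0)))"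
      unfolding sum_distrib_left by (intro sum.cong refl) auto
    finally show ?thesis .
  qed
  have inner: "(\<Sum>S\<in>?D. if K \<subseteq> S then mu S else 0) = (-1) ^ card K * sieve_y P R K" if K: "K \<in> ?D" for K
  proof -
    have "(\<Sum>S\<in>?D. if K \<subseteq> S then mu S else 0)
        = (\<Sum>S\<in>?D. \<Sum>T\<in>?D. if K \<subseteq> S \<and> S \<subseteq> T then (-1) ^ card S * sieve_y P R T else 0)"
      unfolding mu_def sum_distrib_left using finD
      by (intro sum.cong refl) (auto simp: sum.inter_filter[symmetric])
    also have "\<dots> = (\<Sum>T\<in>?D. sieve_y P R T * (\<Sum>S | K \<subseteq> S \<and> S \<subseteq> T. (-1) ^ card S))"
    proof (subst sum.swap, intro sum.cong refl)
      fix T assume T: "T \<in> ?D"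
      have "(\<Sum>S\<in>?D. if K \<subseteq> S \<and> S \<subseteq> T then (-1) ^ card S * sieve_y P R T else 0)
          = (\<Sum>S | S \<in> ?D \<and> K \<subseteq> S \<and> S \<subseteq> T. (-1) ^ card S * sieve_y P R T)"
        by (rule sum.inter_filter[OF finD, symmetric])
      also have "{S. S \<in> ?D \<and> K \<subseteq> S \<and> S \<subseteq> T} = {S. K \<subseteq> S \<and> S \<subseteq> T}"
        using sieve_support_down[OF T] by auto
      finally show "(\<Sum>S\<in>?D. if K \<subseteq> S \<and> S \<subseteq> T then (-1) ^ card S * sieve_y P R T else 0)
         = sieve_y P R T * (\<Sum>S | K \<subseteq> S \<and> S \<subseteq> T. (-1) ^ card S)"
        by (simp add: sum_distrib_left mult.commute)
    qed
    also have "\<dots> = (\<Sum>T\<in>?D. if T = K then (-1) ^ card K * sieve_y P R K else 0)"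
      by (intro sum.cong refl, subst sum_alternating_between[OF fin]) auto
    also have "\<dots> = (-1) ^ card K * sieve_y P R K" using K finD by simp
    finally show ?thesis .
  qed
  have "(\<Sum>S\<in>?D. \<Sum>T\<in>?D. sieve_lambda P R S * sieve_lambda P R T / real (\<Prod>(S \<union> T)))
      = (\<Sum>S\<in>?D. \<Sum>T\<in>?D. \<Sum>K\<in>?D. w K * ((if K \<subseteq> S then mu S else 0) * (if K \<subseteq> T then mu T else 0)))"
    by (intro sum.cong refl summand)
  also have "\<dots> = (\<Sum>S\<in>?D. \<Sum>K\<in>?D. \<Sum>T\<in>?D. w K * ((if K \<subseteq> S then mu S else 0) * (if K \<subseteq> T then mu T else 0)))"
    by (rule sum.cong[OF refl]) (rule sum.swap)
  also have "\<dots> = (\<Sum>K\<in>?D. \<Sum>S\<in>?D. \<Sum>T\<in>?D. w K * ((if K \<subseteq> S then mu S else 0) * (if K \<subseteq> T then mu T else 0)))"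
    by (rule sum.swap)
  also have "\<dots> = (\<Sum>K\<in>?D. w K * ((\<Sum>S\<in>?D. if K \<subseteq> S then mu S else 0) * (\<Sum>T\<in>?D. if K \<subseteq> T then mu T else 0)))"
    unfolding sum_product by (simp only: sum_distrib_left)
  also have "\<dots> = (\<Sum>K\<in>?D. (w K * sieve_y P R K) * sieve_y P R K)"
  proof (intro sum.cong refl)
    fix K assume "K \<in> ?D"
    have "(-1 :: real) ^ card K * (-1) ^ card K = 1" by (simp flip: power_mult_distrib)
    then show "w K * ((\<Sum>S\<in>?D. if K \<subseteq> S then mu S else 0) * (\<Sum>T\<in>?D. if K \<subseteq> T then mu T else 0))
        = (w K * sieve_y P R K) * sieve_y P R K"
      unfolding inner[OF \<open>K \<in> ?D\<close>] by (simp add: algebra_simps)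
  qed
  also have "\<dots> = (\<Sum>K\<in>?D. (1 / sieve_mass P R) * sieve_y P R K)"
    by (intro sum.cong refl) (simp add: w)
  also have "\<dots> = 1 / sieve_mass P R"
    unfolding sum_distrib_left[symmetric] sum_sieve_y by simp
  finally show ?thesis .
qed

definition sieve_nu :: "nat \<Rightarrow> real" where
  "sieve_nu m = (\<Sum>S | S \<in> sieve_support P R \<and> \<Prod>S dvd m. sieve_lambda P R S)\<^sup>2"

lemma sieve_nu_nonneg: "sieve_nu m \<ge> 0"
  by (simp add: sieve_nu_def)

lemma sieve_nu_sifted:
  assumes "\<forall>p\<in>P. \<not> p dvd m"
  shows "sieve_nu m = 1"
proof -
  have "{S. S \<in> sieve_support P R \<and> \<Prod>S dvd m} = {{}}"
  proof (intro equalityI subsetI)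
    fix S assume S: "S \<in> {S. S \<in> sieve_support P R \<and> \<Prod>S dvd m}"
    then have "S \<subseteq> P" "\<forall>p\<in>S. p dvd m"
      using sieve_support_subset prod_P_dvd_iff[of S m] by auto
    then show "S \<in> {{}}" using assms by auto
  qed (use empty_in_sieve_support in auto)
  then show ?thesis by (simp add: sieve_nu_def sieve_lambda_empty)
qed

lemma sum_sieve_nu_mult:
  "(\<Sum>m\<in>{1..x}. sieve_nu m * c m) = (\<Sum>S\<in>sieve_support P R. \<Sum>T\<in>sieve_support P R.
     sieve_lambda P R S * sieve_lambda P R T * (\<Sum>m | m \<in> {1..x} \<and> \<Prod>(S \<union> T) dvd m. c m))"
proof -
  let ?D = "sieve_support P R" and ?l = "sieve_lambda P R"
  have finD: "finite ?D" by (rule finite_sieve_support[OF finP])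
  have nu: "sieve_nu m * c m = (\<Sum>S\<in>?D. \<Sum>T\<in>?D. ?l S * ?l T * (if \<Prod>(S \<union> T) dvd m then c m else 0))" for m
  proof -
    have "sieve_nu m = (\<Sum>S\<in>?D. if \<Prod>S dvd m then ?l S else 0) * (\<Sum>T\<in>?D. if \<Prod>T dvd m then ?l T else 0)"
      by (simp only: sieve_nu_def power2_eq_square sum.inter_filter[OF finD])
    then have "sieve_nu m * c m = (\<Sum>S\<in>?D. \<Sum>T\<in>?D. (if \<Prod>S dvd m then ?l S else 0) * (if \<Prod>T dvd m then ?l T else 0) * c m)"
      by (simp only: sum_product) (simp only: sum_distrib_right)
    also have "\<dots> = (\<Sum>S\<in>?D. \<Sum>T\<in>?D. ?l S * ?l T * (if \<Prod>(S \<union> T) dvd m then c m else 0))"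
    proof (intro sum.cong refl)
      fix S T assume "S \<in> ?D" "T \<in> ?D"
      then have "\<Prod>(S \<union> T) dvd m \<longleftrightarrow> \<Prod>S dvd m \<and> \<Prod>T dvd m"
        using prod_P_dvd_iff[of S m] prod_P_dvd_iff[of T m] prod_P_dvd_iff[of "S \<union> T" m] sieve_support_subset
        by auto
      then show "(if \<Prod>S dvd m then ?l S else 0) * (if \<Prod>T dvd m then ?l T else 0) * c m
          = ?l S * ?l T * (if \<Prod>(S \<union> T) dvd m then c m else 0)" by simp
    qed
    finally show ?thesis .
  qed
  have "(\<Sum>m\<in>{1..x}. sieve_nu m * c m)
      = (\<Sum>S\<in>?D. \<Sum>m\<in>{1..x}. \<Sum>T\<in>?D. ?l S * ?l T * (if \<Prod>(S \<union> T) dvd m then c m else 0))"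
    unfolding nu by (rule sum.swap)
  also have "\<dots> = (\<Sum>S\<in>?D. \<Sum>T\<in>?D. \<Sum>m\<in>{1..x}. ?l S * ?l T * (if \<Prod>(S \<union> T) dvd m then c m else 0))"
    by (rule sum.cong[OF refl]) (rule sum.swap)
  also have "\<dots> = (\<Sum>S\<in>?D. \<Sum>T\<in>?D. ?l S * ?l T * (\<Sum>m | m \<in> {1..x} \<and> \<Prod>(S \<union> T) dvd m. c m))"
    by (simp only: sum_distrib_left[symmetric] sum.inter_filter[OF finite_atLeastAtMost])
  finally show ?thesis .
qed

lemma sum_abs_sieve_lambda_products_le:
  "(\<Sum>S\<in>sieve_support P R. \<Sum>T\<in>sieve_support P R. \<bar>sieve_lambda P R S * sieve_lambda P R T\<bar>) \<le> R ^ 4"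
proof -
  let ?D = "sieve_support P R"
  have 1: "(\<Sum>S\<in>?D. \<bar>sieve_lambda P R S\<bar>) \<le> R * R"
  proof -
    have "(\<Sum>S\<in>?D. \<bar>sieve_lambda P R S\<bar>) \<le> real (card ?D) * R"
      using abs_sieve_lambda_le by (intro sum_bounded_above) auto
    also have "\<dots> \<le> R * R" using card_sieve_support_le R by (intro mult_right_mono) auto
    finally show ?thesis .
  qed
  have "(\<Sum>S\<in>?D. \<Sum>T\<in>?D. \<bar>sieve_lambda P R S * sieve_lambda P R T\<bar>)
      = (\<Sum>S\<in>?D. \<bar>sieve_lambda P R S\<bar>) * (\<Sum>T\<in>?D. \<bar>sieve_lambda P R T\<bar>)"
    by (simp only: abs_mult sum_product)
  also have "\<dots> \<le> (R * R) * (R * R)"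
    using 1 R by (intro mult_mono) (auto intro: sum_nonneg)
  finally show ?thesis by (simp add: power4_eq_xxxx mult.assoc)
qed

text \<open>
The multiples of \<open>d\<close> up to \<open>x\<close> number \<open>x / d\<close> with an error of at most 1: the main term is the
quadratic form, the errors cost the sum of all \<open>\<bar>\<lambda>(d) \<lambda>(e)\<bar>\<close>.
\<close>

lemma sum_sieve_nu_le: "(\<Sum>m\<in>{1..x}. sieve_nu m) \<le> real x / sieve_mass P R + R ^ 4"
proof -
  let ?D = "sieve_support P R" and ?l = "sieve_lambda P R"
  have "(\<Sum>m\<in>{1..x}. sieve_nu m * 1) \<le> (\<Sum>S\<in>?D. \<Sum>T\<in>?D.
       real x * (?l S * ?l T / real (\<Prod>(S \<union> T))) + \<bar>?l S * ?l T\<bar>)"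
    unfolding sum_sieve_nu_mult
  proof (intro sum_mono)
    fix S T assume ST: "S \<in> ?D" "T \<in> ?D"
    define d where "d = \<Prod>(S \<union> T)"
    have d: "d > 0" unfolding d_def using ST sieve_support_subset by (intro prod_P_pos) auto
    have cnt: "(\<Sum>m | m \<in> {1..x} \<and> d dvd m. 1) = real (x div d)"
      by (subst sum_multiples[OF d]) simp
    have "\<bar>real (x div d) - real x / real d\<bar> \<le> 1"
      using floor_divide_of_nat_eq[of x d, where 'a = real] floor_correct[of "real x / real d"] by simp
    then have "\<bar>?l S * ?l T * (real (x div d) - real x / real d)\<bar> \<le> \<bar>?l S * ?l T\<bar> * 1"
      unfolding abs_mult[of "?l S * ?l T"] by (intro mult_left_mono) auto
    then have "?l S * ?l T * real (x div d) \<le> real x * (?l S * ?l T / real d) + \<bar>?l S * ?l T\<bar>"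
      by (simp add: algebra_simps abs_le_iff)
    then show "?l S * ?l T * (\<Sum>m | m \<in> {1..x} \<and> \<Prod>(S \<union> T) dvd m. 1)
        \<le> real x * (?l S * ?l T / real (\<Prod>(S \<union> T))) + \<bar>?l S * ?l T\<bar>"
      unfolding d_def[symmetric] cnt .
  qed
  also have "\<dots> = real x * (\<Sum>S\<in>?D. \<Sum>T\<in>?D. ?l S * ?l T / real (\<Prod>(S \<union> T)))
      + (\<Sum>S\<in>?D. \<Sum>T\<in>?D. \<bar>?l S * ?l T\<bar>)"
    by (simp only: sum.distrib sum_distrib_left)
  also have "\<dots> \<le> real x * (1 / sieve_mass P R) + R ^ 4"
    unfolding sieve_quadratic_form by (intro add_left_mono sum_abs_sieve_lambda_products_le)
  finally show ?thesis by simp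
qed

text \<open>
The character factors out of the sum over the multiples of a fixed \<open>d\<close>, so that any bound for
its initial sums is inherited with the factor \<open>\<Sum> \<bar>\<lambda>(d) \<lambda>(e)\<bar> \<le> R\<^sup>4\<close>.
\<close>

lemma sieve_nu_odd_Jacobi_le:
  assumes "\<And>y. \<bar>\<Sum>m\<in>{1..y}. odd_Jacobi n m\<bar> \<le> B"
  shows "\<bar>\<Sum>m\<in>{1..x}. sieve_nu m * odd_Jacobi n m\<bar> \<le> R ^ 4 * B"
proof -
  let ?D = "sieve_support P R" and ?l = "sieve_lambda P R"
  have B: "B \<ge> 0" using assms[of 0] by simp
  have "\<bar>\<Sum>m\<in>{1..x}. sieve_nu m * odd_Jacobi n m\<bar> \<le> (\<Sum>S\<in>?D. \<Sum>T\<in>?D. \<bar>?l S * ?l T\<bar> * B)"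
    unfolding sum_sieve_nu_mult
  proof (intro order.trans[OF sum_abs] sum_mono)
    fix S T assume ST: "S \<in> ?D" "T \<in> ?D"
    define d where "d = \<Prod>(S \<union> T)"
    have d: "d > 0" unfolding d_def using ST sieve_support_subset by (intro prod_P_pos) auto
    have "(\<Sum>m | m \<in> {1..x} \<and> d dvd m. odd_Jacobi n m) = odd_Jacobi n d * (\<Sum>j\<in>{1..x div d}. odd_Jacobi n j)"
      unfolding sum_multiples[OF d] sum_distrib_left
      by (intro sum.cong refl odd_Jacobi_mult_right d) auto
    then have "\<bar>\<Sum>m | m \<in> {1..x} \<and> d dvd m. odd_Jacobi n m\<bar> \<le> 1 * B"
      unfolding abs_mult
      by (simp only: abs_mult) (intro mult_mono abs_odd_Jacobi_le_1 assms, auto)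
    then show "\<bar>?l S * ?l T * (\<Sum>m | m \<in> {1..x} \<and> \<Prod>(S \<union> T) dvd m. odd_Jacobi n m)\<bar> \<le> \<bar>?l S * ?l T\<bar> * B"
      unfolding d_def[symmetric] abs_mult[of "?l S * ?l T"] by (intro mult_left_mono) auto
  qed
  also have "\<dots> = (\<Sum>S\<in>?D. \<Sum>T\<in>?D. \<bar>?l S * ?l T\<bar>) * B"
    by (simp only: sum_distrib_right)
  also have "\<dots> \<le> R ^ 4 * B"
    by (rule mult_right_mono[OF sum_abs_sieve_lambda_products_le B])
  finally show ?thesis .
qed

end

text \<open>
Level \<open>z\<^sup>5\<close> is what Rankin's trick requires, and the sum of the weights of the square is then at most
\<open>z\<^sup>2\<^sup>0\<close>.
\<close>

lemma Selberg_majorant: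
  assumes P: "finite P" "\<And>p. p \<in> P \<Longrightarrow> prime p \<and> real p \<le> z" and z: "z > 1"
  shows "\<exists>\<nu> :: nat \<Rightarrow> real. (\<forall>m. \<nu> m \<ge> 0) \<and> (\<forall>m. (\<forall>p\<in>P. \<not> p dvd m) \<longrightarrow> \<nu> m = 1) \<and>
    (\<forall>x. (\<Sum>m\<in>{1..x}. \<nu> m) \<le> 2 * real x * (\<Prod>p\<in>P. 1 - 1 / real p) + z ^ 20) \<and>
    (\<forall>n B x. (\<forall>y. \<bar>\<Sum>m\<in>{1..y}. odd_Jacobi n m\<bar> \<le> B) \<longrightarrow>
        \<bar>\<Sum>m\<in>{1..x}. \<nu> m * odd_Jacobi n m\<bar> \<le> z ^ 20 * B)"
proof (intro exI[of _ "sieve_nu P (z ^ 5)"] conjI allI impI)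
  have prm: "\<And>p. p \<in> P \<Longrightarrow> prime p" using P by auto
  have R: "z ^ 5 \<ge> 1" using z by simp
  note ctx = P(1) prm R
  have R4: "(z ^ 5) ^ 4 = z ^ 20" by (simp flip: power_mult)
  show "sieve_nu P (z ^ 5) m \<ge> 0" for m by (rule sieve_nu_nonneg[OF ctx])
  show "sieve_nu P (z ^ 5) m = 1" if "\<forall>p\<in>P. \<not> p dvd m" for m by (rule sieve_nu_sifted[OF ctx that])
  show "\<bar>\<Sum>m\<in>{1..x}. sieve_nu P (z ^ 5) m * odd_Jacobi n m\<bar> \<le> z ^ 20 * B"
    if "\<forall>y. \<bar>\<Sum>m\<in>{1..y}. odd_Jacobi n m\<bar> \<le> B" for n B x
    using sieve_nu_odd_Jacobi_le[OF ctx that[rule_format], of x] unfolding R4 .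
  show "(\<Sum>m\<in>{1..x}. sieve_nu P (z ^ 5) m) \<le> 2 * real x * (\<Prod>p\<in>P. 1 - 1 / real p) + z ^ 20" for x
  proof -
    have V: "(\<Prod>p\<in>P. 1 - 1 / real p) > 0"
      by (intro prod_pos) (use P_ge_2[OF ctx] in fastforce)
    have "1 / sieve_mass P (z ^ 5) \<le> 1 / (1 / (2 * (\<Prod>p\<in>P. 1 - 1 / real p)))"
      by (rule divide_left_mono[OF sieve_mass_ge[OF P z]])
         (use V sieve_mass_pos[OF ctx] in auto)
    then have "real x * (1 / sieve_mass P (z ^ 5)) \<le> real x * (2 * (\<Prod>p\<in>P. 1 - 1 / real p))"
      by (intro mult_left_mono) auto
    then show ?thesis using sum_sieve_nu_le[OF ctx, of x] unfolding R4 by (simp add: mult_ac)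
  qed
qed

section \<open>Pairs whose product is a square\<close>

lemma sum_inverse_squares_tail:
  assumes "k \<ge> 1"
  shows "(\<Sum>u\<in>{k..N}. 1 / (real u)\<^sup>2) \<le> 2 / real k"
proof -
  have "N + 1 \<ge> k \<longrightarrow> (\<Sum>u\<in>{k..N}. 1 / (real u)\<^sup>2) \<le> 2 / real k - 2 / (real N + 1)" for N
  proof (induction N)
    case 0
    then show ?case using assms by (cases "k = 1") auto
  next
    case (Suc N)
    show ?case
    proof
      assume "Suc N + 1 \<ge> k"
      then consider "N + 1 \<ge> k" | "k = Suc N + 1" by linarith
      then show "(\<Sum>u\<in>{k..Suc N}. 1 / (real u)\<^sup>2) \<le> 2 / real k - 2 / (real (Suc N) + 1)"
      proof cases
        case 1
        have "1 / (real N + 1)\<^sup>2 \<le> 2 / (real N + 1) - 2 / (real N + 2)"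
          by (simp add: divide_simps power2_eq_square)
        then show ?thesis using Suc 1 by (simp add: add.commute)
      qed (simp add: add.commute)
    qed
  qed
  from this[of N] show ?thesis
  proof (cases "N + 1 \<ge> k")
    case True
    have "2 / (real N + 1) \<ge> 0" by simp
    with True \<open>N + 1 \<ge> k \<longrightarrow> _\<close> show ?thesis by linarith
  qed auto
qed

lemma sum_inverse_squares_le_2: "(\<Sum>u\<in>{1..N}. 1 / (real u)\<^sup>2) \<le> 2"
  using sum_inverse_squares_tail[of 1 N] by simp

lemma sum_inverse_squares_gt:
  assumes "y > 0"
  shows "(\<Sum>u | u \<in> {1..N} \<and> y < real u. 1 / (real u)\<^sup>2) \<le> 2 / y"
proof -
  define k where "k = Suc (nat \<lfloor>y\<rfloor>)"
  have k: "real k > y" unfolding k_def using assms by linarith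
  have "u \<ge> k" if "y < real u" for u
    using that assms unfolding k_def by linarith
  then have "(\<Sum>u | u \<in> {1..N} \<and> y < real u. 1 / (real u)\<^sup>2) \<le> (\<Sum>u\<in>{k..N}. 1 / (real u)\<^sup>2)"
    by (intro sum_mono2) auto
  also have "\<dots> \<le> 2 / real k" by (rule sum_inverse_squares_tail) (simp add: k_def)
  also have "\<dots> \<le> 2 / y" using k assms by (intro divide_left_mono) auto
  finally show ?thesis .
qed

text \<open>
After division by the gcd the two numbers are coprime and their product is still a square.
\<close>

lemma square_pair_decompose:
  fixes a b :: nat
  assumes "is_nth_power 2 (a * b)" "a > 0" "b > 0"
  obtains g u v where "a = g * u\<^sup>2" "b = g * v\<^sup>2"
proof -
  define g x y where "g = gcd a b" and "x = a div g" and "y = b div g"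
  have g: "g > 0" "g dvd a" "g dvd b" using assms by (auto simp: g_def)
  have a: "a = g * x" and b: "b = g * y" using g by (auto simp: x_def y_def)
  have cop: "coprime x y" unfolding x_def y_def g_def
    using assms by (intro div_gcd_coprime) auto
  have "is_nth_power 2 (g\<^sup>2 * (x * y))"
    using assms(1) by (simp add: a b power2_eq_square mult_ac)
  then have "is_nth_power 2 (x * y)"
    by (subst (asm) is_nth_power_mult_cancel_left) (use g in auto)
  then have "is_nth_power 2 x" "is_nth_power 2 y"
    using is_nth_power_mult_coprime_nat_iff[OF cop, of 2] by auto
  then obtain u v where "x = u\<^sup>2" "y = v\<^sup>2" by (auto elim!: is_nth_powerE)
  then show ?thesis using that a b by blast
qed

text \<open>
Over the triples \<open>(g, u, v)\<close> with \<open>g u\<^sup>2, g v\<^sup>2 > W\<close>, each of the sums over \<open>u\<close> and \<open>v\<close> of the reciprocal squares is at most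
\<open>2 sqrt (g / W)\<close>. The factor \<open>1 / g\<^sup>2\<close> then leaves \<open>4 / (g W)\<close>, and a harmonic sum over \<open>g\<close>.
\<close>

lemma diagonal_sum_le:
  assumes W: "W > 0" and I: "\<And>n. n \<in> I \<Longrightarrow> W < real n \<and> n \<le> N" and N: "N \<ge> 1"
  shows "(\<Sum>(a, b) | a \<in> I \<and> b \<in> I \<and> is_nth_power 2 (a * b). 1 / (real a * real b)) \<le> 4 / W * (1 + ln (real N))"
proof -
  let ?X = "{(a, b). a \<in> I \<and> b \<in> I \<and> is_nth_power 2 (a * b)}"
  let ?U = "\<lambda>g. {u. u \<in> {1..N} \<and> sqrt (W / real g) < real u}"
  let ?Y = "SIGMA g:{1..N}. ?U g \<times> ?U g"
  let ?h = "\<lambda>(g, u, v). (g * u\<^sup>2, g * v\<^sup>2) :: nat \<times> nat"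
  let ?F = "\<lambda>(g, u, v). (1 / (real g)\<^sup>2) * ((1 / (real u)\<^sup>2) * (1 / (real v)\<^sup>2))"
  have finY: "finite ?Y" by (intro finite_SigmaI finite_cartesian_product) auto
  have "finite I" by (rule finite_subset[of _ "{..N}"]) (use I in auto)
  then have finX: "finite ?X" by (intro finite_subset[of ?X "I \<times> I"]) auto
  have "(\<Sum>(a, b)\<in>?X. 1 / (real a * real b)) \<le> (\<Sum>t\<in>?Y. ?F t)"
  proof (rule sum_le_included[OF finX finY, where i = ?h])
    show "\<forall>t\<in>?Y. 0 \<le> ?F t" by auto
    show "\<forall>s\<in>?X. \<exists>t\<in>?Y. ?h t = s \<and> (case s of (a, b) \<Rightarrow> 1 / (real a * real b)) \<le> ?F t"
    proof
      fix s assume "s \<in> ?X"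
      then obtain a b where s: "s = (a, b)" "a \<in> I" "b \<in> I" "is_nth_power 2 (a * b)" by auto
      have pos: "a > 0" "b > 0" using I[OF s(2)] I[OF s(3)] W by (auto intro: gr0I)
      obtain g u v where guv: "a = g * u\<^sup>2" "b = g * v\<^sup>2"
        using square_pair_decompose[OF s(4) pos] by blast
      have pos': "g > 0" "u > 0" "v > 0" using pos guv by (auto intro: gr0I)
      have mem: "u \<in> ?U g \<and> g \<in> {1..N}" if "n = g * u\<^sup>2" "W < real n" "n \<le> N" "u > 0" for n u
      proof -
        have "W / real g < (real u)\<^sup>2"
          using that(1,2) pos'(1) by (simp add: divide_simps mult.commute)
        then have "sqrt (W / real g) < real u"
          by (metis of_nat_0_le_iff real_sqrt_less_iff real_sqrt_unique)
        moreover have "u \<le> n" "g \<le> n"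
          using that(1,4) pos'(1) by (auto intro!: dvd_imp_le simp: power2_eq_square)
        ultimately show ?thesis using that(3,4) pos'(1) by auto
      qed
      have "(g, u, v) \<in> ?Y"
        using mem[OF guv(1)] mem[OF guv(2)] I[OF s(2)] I[OF s(3)] pos' by auto
      moreover have "?h (g, u, v) = s" using guv s by simp
      moreover have "(case s of (a, b) \<Rightarrow> 1 / (real a * real b)) \<le> ?F (g, u, v)"
        using guv s by (simp add: power2_eq_square mult_ac)
      ultimately show "\<exists>t\<in>?Y. ?h t = s \<and> (case s of (a, b) \<Rightarrow> 1 / (real a * real b)) \<le> ?F t"
        by blast
    qed
  qed
  also have "\<dots> = (\<Sum>g\<in>{1..N}. (1 / (real g)\<^sup>2) * ((\<Sum>u\<in>?U g. 1 / (real u)\<^sup>2) * (\<Sum>v\<in>?U g. 1 / (real v)\<^sup>2)))"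
  proof -
    have "(1 / (real g)\<^sup>2) * ((\<Sum>u\<in>?U g. 1 / (real u)\<^sup>2) * (\<Sum>v\<in>?U g. 1 / (real v)\<^sup>2))
        = (\<Sum>s\<in>?U g \<times> ?U g. ?F (g, s))" for g
      by (subst sum_product, subst sum.cartesian_product, subst sum_distrib_left)
         (intro sum.cong refl, simp only: case_prod_unfold fst_conv snd_conv)
    then have "(\<Sum>g\<in>{1..N}. (1 / (real g)\<^sup>2) * ((\<Sum>u\<in>?U g. 1 / (real u)\<^sup>2) * (\<Sum>v\<in>?U g. 1 / (real v)\<^sup>2)))
        = (\<Sum>g\<in>{1..N}. \<Sum>s\<in>?U g \<times> ?U g. ?F (g, s))"
      by (intro sum.cong refl) blast
    also have "\<dots> = (\<Sum>(g, s)\<in>?Y. ?F (g, s))"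
      by (rule sum.Sigma) auto
    also have "\<dots> = (\<Sum>t\<in>?Y. ?F t)"
      by (intro sum.cong refl) auto
    finally show ?thesis ..
  qed
  also have "\<dots> \<le> (\<Sum>g\<in>{1..N}. (4 / W) * inverse (real g))"
  proof (rule sum_mono)
    fix g assume g: "g \<in> {1..N}"
    then have y: "sqrt (W / real g) > 0" using W by simp
    have "(\<Sum>u\<in>?U g. 1 / (real u)\<^sup>2) * (\<Sum>v\<in>?U g. 1 / (real v)\<^sup>2) \<le> (2 / sqrt (W / real g)) * (2 / sqrt (W / real g))"
      using sum_inverse_squares_gt[OF y, of N] y by (intro mult_mono) (auto intro!: sum_nonneg)
    also have "\<dots> = 4 * real g / W" using g W by (simp add: real_sqrt_mult_self)
    finally have "(1 / (real g)\<^sup>2) * ((\<Sum>u\<in>?U g. 1 / (real u)\<^sup>2) * (\<Sum>v\<in>?U g. 1 / (real v)\<^sup>2)) \<le> (1 / (real g)\<^sup>2) * (4 * real g / W)"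
      by (intro mult_left_mono) auto
    also have "\<dots> = (4 / W) * inverse (real g)"
      using g W by (simp add: divide_simps power2_eq_square)
    finally show "(1 / (real g)\<^sup>2) * ((\<Sum>u\<in>?U g. 1 / (real u)\<^sup>2) * (\<Sum>v\<in>?U g. 1 / (real v)\<^sup>2)) \<le> (4 / W) * inverse (real g)" .
  qed
  also have "\<dots> = (4 / W) * harm N" by (simp only: sum_distrib_left harm_def)
  also have "\<dots> \<le> (4 / W) * (1 + ln (real N))"
    using harm_le_1_plus_ln[of N] N W by (intro mult_left_mono) auto
  finally show ?thesis by (simp only: case_prod_unfold)
qed

lemma sum_inverse_sqrt_le:
  "(\<Sum>n\<in>{1..N}. 1 / sqrt (real n)) \<le> 2 * sqrt (real N)"
proof (induction N)
  case (Suc N)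
  have "1 / sqrt (real N + 1) \<le> 2 * sqrt (real N + 1) - 2 * sqrt (real N)"
  proof -
    have "(sqrt (real N + 1) - sqrt (real N)) * (sqrt (real N + 1) + sqrt (real N)) = 1"
      by (simp add: algebra_simps)
    moreover have "(sqrt (real N + 1) - sqrt (real N)) * (sqrt (real N + 1) + sqrt (real N))
      \<le> (sqrt (real N + 1) - sqrt (real N)) * (2 * sqrt (real N + 1))"
      by (intro mult_left_mono) auto
    ultimately show ?thesis by (simp add: divide_simps algebra_simps)
  qed
  then show ?case using Suc by (simp add: add.commute)
qed simp

section \<open>The second moment over sifted integers\<close>

text \<open>
Here the sieve and the character sums meet: majorise the sifting condition by \<open>\<nu>\<close>, open the square,
and use the mean of \<open>\<nu>\<close> when \<open>a b\<close> is a square and Polya--Vinogradov otherwise.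
\<close>

lemma sifted_second_moment_le:
  fixes c :: "nat \<Rightarrow> complex"
  assumes P: "finite P" "\<And>p. p \<in> P \<Longrightarrow> prime p \<and> real p \<le> z" and z: "z > 1"
    and I: "I \<subseteq> {n \<in> {1..N}. odd n}" and N: "N \<ge> 1"
    and c: "\<And>n. n \<in> I \<Longrightarrow> norm (c n) \<le> 1 / real n"
  defines "\<Delta> \<equiv> \<Sum>(a, b) | a \<in> I \<and> b \<in> I \<and> is_nth_power 2 (a * b). 1 / (real a * real b)"
  shows "(\<Sum>m | m \<in> {1..x} \<and> (\<forall>p\<in>P. \<not> p dvd m). (norm (\<Sum>n\<in>I. c n * of_real (odd_Jacobi n m)))\<^sup>2)
    \<le> (2 * real x * (\<Prod>p\<in>P. 1 - 1 / real p) + z ^ 20) * \<Delta> + z ^ 20 * (8 * real N * (1 + 2 * ln (real N)))"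
proof -
  obtain nu where "(\<forall>m. nu m \<ge> 0) \<and> (\<forall>m. (\<forall>p\<in>P. \<not> p dvd m) \<longrightarrow> nu m = 1) \<and>
    (\<forall>x. (\<Sum>m\<in>{1..x}. nu m) \<le> 2 * real x * (\<Prod>p\<in>P. 1 - 1 / real p) + z ^ 20) \<and>
    (\<forall>n B x. (\<forall>y. \<bar>\<Sum>m\<in>{1..y}. odd_Jacobi n m\<bar> \<le> B) \<longrightarrow>
        \<bar>\<Sum>m\<in>{1..x}. nu m * odd_Jacobi n m\<bar> \<le> z ^ 20 * B)"
    using Selberg_majorant[OF P z] by blast
  then have nu: "\<And>m. nu m \<ge> 0" "\<And>m. \<forall>p\<in>P. \<not> p dvd m \<Longrightarrow> nu m = 1"
    "\<And>x. (\<Sum>m\<in>{1..x}. nu m) \<le> 2 * real x * (\<Prod>p\<in>P. 1 - 1 / real p) + z ^ 20"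
    "\<And>n B x. (\<forall>y. \<bar>\<Sum>m\<in>{1..y}. odd_Jacobi n m\<bar> \<le> B) \<Longrightarrow>
        \<bar>\<Sum>m\<in>{1..x}. nu m * odd_Jacobi n m\<bar> \<le> z ^ 20 * B"
    by blast+
  define T where "T = 2 * real x * (\<Prod>p\<in>P. 1 - 1 / real p) + z ^ 20"
  define A where "A m = (\<Sum>n\<in>I. c n * of_real (odd_Jacobi n m))" for m
  have finI: "finite I" using I by (rule finite_subset) auto
  have I_pos: "n \<ge> 1" "n \<le> N" "odd n" if "n \<in> I" for n using I that by auto
  \<comment> \<open>bound for the pair \<open>(a, b)\<close>: the mean of the majorant if \<open>a b\<close> is a square, and a
    Polya--Vinogradov term, kept for all pairs so that it factors\<close>
  define t where "t a b = (if is_nth_power 2 (a * b) then T * (1 / (real a * real b)) else 0)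
     + z ^ 20 * (2 * (1 + 2 * ln (real N))) * ((1 / sqrt (real a)) * (1 / sqrt (real b)))" for a b :: nat
  have nu_sum: "norm (\<Sum>m\<in>{1..x}. c a * cnj (c b) * of_real (nu m * odd_Jacobi (a * b) m)) \<le> t a b"
    if ab: "a \<in> I" "b \<in> I" for a b
  proof -
    have ab': "a \<ge> 1" "b \<ge> 1" "a \<le> N" "b \<le> N" "odd (a * b)" using I_pos[OF ab(1)] I_pos[OF ab(2)] by auto
    have "norm (\<Sum>m\<in>{1..x}. c a * cnj (c b) * of_real (nu m * odd_Jacobi (a * b) m))
       = norm (c a) * norm (c b) * \<bar>\<Sum>m\<in>{1..x}. nu m * odd_Jacobi (a * b) m\<bar>"
      unfolding sum_distrib_left[symmetric] of_real_sum[symmetric] norm_mult complex_mod_cnj norm_of_real ..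
    also have "\<dots> \<le> (1 / real a) * (1 / real b) * \<bar>\<Sum>m\<in>{1..x}. nu m * odd_Jacobi (a * b) m\<bar>"
      using c[OF ab(1)] c[OF ab(2)] by (intro mult_right_mono mult_mono) auto
    also have "\<dots> \<le> t a b"
    proof (cases "is_nth_power 2 (a * b)")
      case True
      have "\<bar>\<Sum>m\<in>{1..x}. nu m * odd_Jacobi (a * b) m\<bar> \<le> (\<Sum>m\<in>{1..x}. nu m)"
      proof (intro order.trans[OF sum_abs] sum_mono)
        fix m
        have "nu m * \<bar>odd_Jacobi (a * b) m\<bar> \<le> nu m * 1"
          by (intro mult_left_mono abs_odd_Jacobi_le_1 nu)
        then show "\<bar>nu m * odd_Jacobi (a * b) m\<bar> \<le> nu m" using nu(1)[of m] by (simp add: abs_mult)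
      qed
      also have "\<dots> \<le> T" unfolding T_def by (rule nu(3))
      finally have "(1 / real a) * (1 / real b) * \<bar>\<Sum>m\<in>{1..x}. nu m * odd_Jacobi (a * b) m\<bar>
          \<le> (1 / real a) * (1 / real b) * T" by (intro mult_left_mono) auto
      moreover have "0 \<le> z ^ 20 * (2 * (1 + 2 * ln (real N))) * ((1 / sqrt (real a)) * (1 / sqrt (real b)))"
        using z N by (intro mult_nonneg_nonneg) auto
      ultimately show ?thesis using True by (simp add: t_def mult_ac)
    next
      case False
      have "\<bar>\<Sum>m\<in>{1..x}. nu m * odd_Jacobi (a * b) m\<bar> \<le> z ^ 20 * (2 * sqrt (real (a * b)) * (1 + ln (real (a * b))))"
        by (intro nu(4) allI Polya_Vinogradov False ab')
      also have "\<dots> \<le> z ^ 20 * (2 * sqrt (real (a * b)) * (1 + 2 * ln (real N)))"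
      proof -
        have "ln (real (a * b)) = ln (real a) + ln (real b)" using ab' by (simp add: ln_mult)
        also have "ln (real a) \<le> ln (real N)" using ab' by simp
        also have "ln (real b) \<le> ln (real N)" using ab' by simp
        also have "ln (real N) + ln (real N) = 2 * ln (real N)" by simp
        finally show ?thesis using z by (intro mult_left_mono) auto
      qed
      finally have "(1 / real a) * (1 / real b) * \<bar>\<Sum>m\<in>{1..x}. nu m * odd_Jacobi (a * b) m\<bar>
          \<le> (1 / real a) * (1 / real b) * (z ^ 20 * (2 * sqrt (real (a * b)) * (1 + 2 * ln (real N))))"
        by (intro mult_left_mono) auto
      also have "\<dots> = z ^ 20 * (2 * (1 + 2 * ln (real N))) * ((sqrt (real a) / real a) * (sqrt (real b) / real b))"
        unfolding of_nat_mult real_sqrt_mult by (simp only: divide_inverse mult_1_left mult_ac)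
      also have "sqrt (real a) / real a = 1 / sqrt (real a)"
        using ab' by (simp add: divide_simps)
      also have "sqrt (real b) / real b = 1 / sqrt (real b)"
        using ab' by (simp add: divide_simps)
      finally show ?thesis using False by (simp add: t_def)
    qed
    finally show ?thesis .
  qed
  have "(\<Sum>m | m \<in> {1..x} \<and> (\<forall>p\<in>P. \<not> p dvd m). (norm (A m))\<^sup>2)
     = (\<Sum>m | m \<in> {1..x} \<and> (\<forall>p\<in>P. \<not> p dvd m). nu m * (norm (A m))\<^sup>2)"
    by (intro sum.cong refl) (simp add: nu(2))
  also have "\<dots> \<le> (\<Sum>m\<in>{1..x}. nu m * (norm (A m))\<^sup>2)"
    by (intro sum_mono2) (auto simp: nu(1))
  also have "\<dots> = norm (complex_of_real (\<Sum>m\<in>{1..x}. nu m * (norm (A m))\<^sup>2))"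
    using nu(1) by (simp add: sum_nonneg del: of_real_sum)
  also have "complex_of_real (\<Sum>m\<in>{1..x}. nu m * (norm (A m))\<^sup>2)
     = (\<Sum>m\<in>{1..x}. \<Sum>a\<in>I. \<Sum>b\<in>I. c a * cnj (c b) * of_real (nu m * odd_Jacobi (a * b) m))"
  proof -
    have "complex_of_real (nu m * (norm (A m))\<^sup>2) = (\<Sum>a\<in>I. \<Sum>b\<in>I. c a * cnj (c b) * of_real (nu m * odd_Jacobi (a * b) m))" for m
    proof -
      have "complex_of_real (nu m * (norm (A m))\<^sup>2) = of_real (nu m) * (A m * cnj (A m))"
        by (simp only: of_real_mult complex_norm_square)
      also have "\<dots> = (\<Sum>a\<in>I. \<Sum>b\<in>I. of_real (nu m) * ((c a * of_real (odd_Jacobi a m)) * (cnj (c b) * of_real (odd_Jacobi b m))))"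
        unfolding A_def cnj_sum sum_product complex_cnj_mult complex_cnj_complex_of_real by (simp only: sum_distrib_left)
      finally show ?thesis by (simp add: odd_Jacobi_mult_left mult_ac)
    qed
    then show ?thesis by simp
  qed
  also have "\<dots> = (\<Sum>a\<in>I. \<Sum>b\<in>I. \<Sum>m\<in>{1..x}. c a * cnj (c b) * of_real (nu m * odd_Jacobi (a * b) m))"
    by (subst sum.swap, rule sum.cong[OF refl], rule sum.swap)
  also have "norm \<dots> \<le> (\<Sum>a\<in>I. \<Sum>b\<in>I. t a b)"
    by (intro sum_norm_le nu_sum)
  also have "\<dots> = T * \<Delta> + z ^ 20 * (2 * (1 + 2 * ln (real N))) * ((\<Sum>a\<in>I. 1 / sqrt (real a)) * (\<Sum>b\<in>I. 1 / sqrt (real b)))"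
  proof -
    have "(\<Sum>a\<in>I. \<Sum>b\<in>I. if is_nth_power 2 (a * b) then T * (1 / (real a * real b)) else 0)
        = (\<Sum>(a, b)\<in>I \<times> I. if is_nth_power 2 (a * b) then T * (1 / (real a * real b)) else 0)"
      by (rule sum.cartesian_product)
    also have "\<dots> = (\<Sum>s\<in>I \<times> I. if (case s of (a, b) \<Rightarrow> is_nth_power 2 (a * b)) then T * (case s of (a, b) \<Rightarrow> 1 / (real a * real b)) else 0)"
      by (intro sum.cong refl) auto
    also have "\<dots> = (\<Sum>s | s \<in> I \<times> I \<and> (case s of (a, b) \<Rightarrow> is_nth_power 2 (a * b)). T * (case s of (a, b) \<Rightarrow> 1 / (real a * real b)))"
      by (rule sum.inter_filter[symmetric]) (use finI in auto)
    also have "{s. s \<in> I \<times> I \<and> (case s of (a, b) \<Rightarrow> is_nth_power 2 (a * b))} = {(a, b). a \<in> I \<and> b \<in> I \<and> is_nth_power 2 (a * b)}"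
      by auto
    finally have "(\<Sum>a\<in>I. \<Sum>b\<in>I. if is_nth_power 2 (a * b) then T * (1 / (real a * real b)) else 0) = T * \<Delta>"
      unfolding \<Delta>_def sum_distrib_left .
    then show ?thesis unfolding t_def sum.distrib
      by (simp only: sum_product) (simp only: sum_distrib_left)
  qed
  also have "\<dots> \<le> T * \<Delta> + z ^ 20 * (2 * (1 + 2 * ln (real N))) * ((2 * sqrt (real N)) * (2 * sqrt (real N)))"
  proof -
    have "(\<Sum>a\<in>I. 1 / sqrt (real a)) \<le> (\<Sum>a\<in>{1..N}. 1 / sqrt (real a))"
      using I by (intro sum_mono2) auto
    then have "(\<Sum>a\<in>I. 1 / sqrt (real a)) \<le> 2 * sqrt (real N)"
      using sum_inverse_sqrt_le[of N] by linarith
    then show ?thesis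
      using z N by (intro add_left_mono mult_left_mono mult_mono) (auto intro!: sum_nonneg mult_nonneg_nonneg)
  qed
  also have "\<dots> = T * \<Delta> + z ^ 20 * (8 * real N * (1 + 2 * ln (real N)))"
    by (simp add: mult_ac)
  finally show ?thesis unfolding A_def T_def .
qed

section \<open>Sieve density under the Mertens condition\<close>

lemma prod_prime_factors_squarefree:
  assumes "squarefree (q::nat)"
  shows "\<Prod>(prime_factors q) = q"
proof -
  have q: "q \<noteq> 0" using assms by (metis not_squarefree_0)
  have "(\<Prod>p\<in>prime_factors q. p) = (\<Prod>p\<in>prime_factors q. p ^ multiplicity p q)"
  proof (intro prod.cong refl)
    fix p assume p: "p \<in> prime_factors q"
    then have "multiplicity p q > 0" "prime p" using q by (auto simp: prime_factors_multiplicity)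
    moreover have "multiplicity p q < 2"
      using assms squarefreeD[of q p] \<open>prime p\<close> multiplicity_dvd'[of 2 p q] not_prime_unit[of p]
      by (meson leI)
    ultimately have "multiplicity p q = 1" by linarith
    then show "p = p ^ multiplicity p q" by simp
  qed
  also have "\<dots> = q" using prod_prime_factors[OF q] by simp
  finally show ?thesis by simp
qed

text \<open>
Each \<open>m \<le> n\<close> is uniquely a square times a product of distinct primes, and the reciprocals of the squares
add up to at most 2.
\<close>

lemma harm_le_Euler_product:
  assumes Q: "finite Q" "\<And>p. prime p \<Longrightarrow> p \<le> n \<Longrightarrow> p \<in> Q"
  shows "harm n \<le> 2 * (\<Prod>p\<in>Q. 1 + 1 / real p)"
proof -
  let ?Y = "{1..n} \<times> Pow Q"
  let ?h = "\<lambda>(k, S). k\<^sup>2 * \<Prod>S :: nat"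
  let ?F = "\<lambda>(k, S). (1 / (real k)\<^sup>2) * (\<Prod>p\<in>S. 1 / real p)"
  have "harm n \<le> (\<Sum>t\<in>?Y. ?F t)"
    unfolding harm_def
  proof (rule sum_le_included[where i = ?h])
    show "finite ?Y" using Q by auto
    show "\<forall>t\<in>?Y. 0 \<le> ?F t" by (auto intro!: divide_nonneg_nonneg prod_nonneg)
    show "\<forall>m\<in>{1..n}. \<exists>t\<in>?Y. ?h t = m \<and> inverse (real m) \<le> ?F t"
    proof
      fix m assume m: "m \<in> {1..n}"
      \<comment> \<open>the square part and the set of primes of the squarefree part index the term \<open>1 / m\<close>\<close>
      define k q where "k = square_part m" and "q = squarefree_part m"
      have mkq: "q * k\<^sup>2 = m" unfolding k_def q_def by (rule squarefree_decompose[symmetric])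
      have pq: "\<Prod>(prime_factors q) = q"
        by (rule prod_prime_factors_squarefree) (simp add: q_def)
      have pos: "k > 0" "q > 0" using mkq m by (auto intro: gr0I)
      have "k dvd m" "q dvd m" unfolding mkq[symmetric] by (auto simp: power2_eq_square)
      then have le: "k \<le> n" "q \<le> n" using m dvd_imp_le[of k m] dvd_imp_le[of q m] by auto
      have "prime_factors q \<subseteq> Q"
      proof
        fix p assume "p \<in> prime_factors q"
        then have "prime p" "p dvd q" by auto
        moreover from this have "p \<le> n" using pos le dvd_imp_le[of p q] by linarith
        ultimately show "p \<in> Q" using Q by blast
      qed
      then have "(k, prime_factors q) \<in> ?Y" using pos le by auto
      moreover have "?h (k, prime_factors q) = m" using mkq pq by (simp add: mult.commute)
      moreover have "inverse (real m) \<le> ?F (k, prime_factors q)"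
      proof -
        have "real m = real q * (real k)\<^sup>2" unfolding mkq[symmetric] by simp
        moreover have "(\<Prod>p\<in>prime_factors q. 1 / real p) = 1 / real (\<Prod>(prime_factors q))"
          by (simp add: prod_dividef)
        ultimately show ?thesis unfolding pq by (simp add: divide_simps)
      qed
      ultimately show "\<exists>t\<in>?Y. ?h t = m \<and> inverse (real m) \<le> ?F t" by blast
    qed
  qed auto
  also have "\<dots> = (\<Sum>k\<in>{1..n}. 1 / (real k)\<^sup>2) * (\<Sum>S\<in>Pow Q. \<Prod>p\<in>S. 1 / real p)"
    unfolding sum_product sum.cartesian_product ..
  also have "(\<Sum>S\<in>Pow Q. \<Prod>p\<in>S. 1 / real p) = (\<Prod>p\<in>Q. 1 / real p + 1)"
    by (subst prod_add[OF Q(1)]) simp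
  also have "(\<Sum>k\<in>{1..n}. 1 / (real k)\<^sup>2) * \<dots> \<le> 2 * (\<Prod>p\<in>Q. 1 / real p + 1)"
    by (intro mult_right_mono sum_inverse_squares_le_2 prod_nonneg) auto
  finally show ?thesis by (simp add: add.commute)
qed

lemma sum_inverse_primes_ge:
  assumes z: "z \<ge> 2"
  shows "(\<Sum>p | prime p \<and> real p \<le> z. 1 / real p) \<ge> ln (ln z) - ln 2"
proof -
  let ?Q = "{p. prime p \<and> real p \<le> z}"
  define n where "n = nat \<lfloor>z\<rfloor>"
  have finQ: "finite ?Q" by (rule finite_subset[of _ "{..n}"]) (auto simp: n_def le_nat_floor)
  have lnz: "ln z > 0" using z by simp
  have "z < real n + 1" using z unfolding n_def by linarith
  then have "ln z \<le> ln (real n + 1)" using z by simp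
  also have "\<dots> \<le> harm n" by (rule ln_le_harm)
  also have "\<dots> \<le> 2 * (\<Prod>p\<in>?Q. 1 + 1 / real p)"
    by (rule harm_le_Euler_product[OF finQ]) (use z in \<open>auto simp: n_def le_nat_iff le_floor_iff\<close>)
  also have "\<dots> \<le> 2 * exp (\<Sum>p\<in>?Q. 1 / real p)"
    unfolding exp_sum[OF finQ] by (intro mult_left_mono prod_mono) (auto intro: exp_ge_add_one_self)
  finally have "ln (ln z) \<le> ln (2 * exp (\<Sum>p\<in>?Q. 1 / real p))"
    using lnz by simp
  then show ?thesis by (simp add: ln_mult)
qed

text \<open>
The inequality \<open>1 - t \<le> exp (- t)\<close> turns the product into the difference of the sums of \<open>f(p) / p\<close>, bounded
above by hypothesis, and of \<open>1 / p\<close>, bounded below by Mertens.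
\<close>

lemma sieve_density_le:
  assumes f: "\<And>p. prime p \<Longrightarrow> 0 \<le> f p \<and> f p \<le> 1" and m: "mertens_mean f \<alpha> K" and z: "z \<ge> 2"
  shows "(\<Prod>p | prime p \<and> real p \<le> z. 1 - (1 - f p) / real p) \<le> 2 * exp K * ln z powr (\<alpha> - 1)"
proof -
  let ?Q = "{p. prime p \<and> real p \<le> z}"
  have finQ: "finite ?Q" by (rule finite_subset[of _ "{..nat \<lfloor>z\<rfloor>}"]) (auto simp: le_nat_floor)
  have lnz: "ln z > 0" using z by simp
  have "(\<Prod>p\<in>?Q. 1 - (1 - f p) / real p) \<le> (\<Prod>p\<in>?Q. exp (- ((1 - f p) / real p)))"
  proof (intro prod_mono conjI)
    fix p assume p: "p \<in> ?Q"
    then have "(1 - f p) / real p \<le> 1 / 1"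
      using f[of p] prime_ge_1_nat[of p] by (intro frac_le) auto
    then show "0 \<le> 1 - (1 - f p) / real p" by simp
    show "1 - (1 - f p) / real p \<le> exp (- ((1 - f p) / real p))"
      using exp_ge_add_one_self[of "- ((1 - f p) / real p)"] by simp
  qed
  also have "\<dots> = exp ((\<Sum>p\<in>?Q. f p / real p) - (\<Sum>p\<in>?Q. 1 / real p))"
    by (simp add: exp_sum[OF finQ, symmetric] sum_subtractf[symmetric] diff_divide_distrib)
  also have "\<dots> \<le> exp ((\<alpha> * ln (ln z) + K) - (ln (ln z) - ln 2))"
  proof -
    have "\<bar>(\<Sum>p\<in>?Q. f p / real p) - \<alpha> * ln (ln z)\<bar> \<le> K"
      using m z unfolding mertens_mean_def by blast
    then have "(\<Sum>p\<in>?Q. f p / real p) \<le> \<alpha> * ln (ln z) + K" by linarith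
    then show ?thesis using sum_inverse_primes_ge[OF z] by simp
  qed
  also have "(\<alpha> * ln (ln z) + K) - (ln (ln z) - ln 2) = ln 2 + K + (\<alpha> - 1) * ln (ln z)"
    by (simp add: algebra_simps)
  also have "exp \<dots> = 2 * exp K * ln z powr (\<alpha> - 1)"
    using lnz by (simp add: exp_add powr_def)
  finally show ?thesis .
qed

section \<open>Multiplicative weights as averages of sieves\<close>

lemma abs_admissible_le:
  assumes f: "admissible f"
  shows "m > 0 \<Longrightarrow> \<bar>f m\<bar> \<le> (\<Prod>p\<in>prime_factors m. f p)"
proof (induction m rule: less_induct)
  case (less m)
  show ?case
  proof (cases "m = 1")
    case True
    then show ?thesis using f by (simp add: admissible_def multiplicative_fun_def)
  next
    case False
    then obtain p where p: "prime p" "p dvd m" using prime_factor_nat by blast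
    define k where "k = multiplicity p m"
    obtain y where y: "m = p ^ k * y" "\<not> p dvd y"
      unfolding k_def
      by (rule multiplicity_decompose'[of m p]) (use less.prems p(1) not_prime_unit in auto)
    have k: "k \<ge> 1" using y p by (cases k) auto
    have y0: "y > 0" using y(1) less.prems by (auto intro: gr0I)
    have p1: "p > 1" using prime_gt_1_nat[OF p(1)] .
    have pk: "p ^ k > 1" using one_less_power[OF p1, of k] k by simp
    then have "y < m" using y0 unfolding y(1) by simp
    have cop: "coprime (p ^ k) y" using y(2) p(1) prime_imp_coprime[of p y] by simp
    have fp: "0 \<le> f p" "\<bar>f (p ^ k)\<bar> \<le> f p"
    proof -
      have *: "0 \<le> f p" "\<forall>j\<ge>2. \<bar>f (p ^ j)\<bar> \<le> f p" using f p(1) by (auto simp: admissible_def)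
      show "0 \<le> f p" by (rule *)
      show "\<bar>f (p ^ k)\<bar> \<le> f p" using * k by (cases "k = 1") auto
    qed
    have pf: "prime_factors m = insert p (prime_factors y)"
      using k y0 p(1) p1 unfolding y(1)
      by (subst prime_factors_product) (auto simp: prime_factors_power prime_prime_factors)
    have "f m = f (p ^ k) * f y"
      using f cop y0 p1 unfolding y(1) admissible_def multiplicative_fun_def by auto
    then have "\<bar>f m\<bar> = \<bar>f (p ^ k)\<bar> * \<bar>f y\<bar>" by (simp add: abs_mult)
    also have "\<dots> \<le> f p * (\<Prod>p\<in>prime_factors y. f p)"
      using less.IH[OF \<open>y < m\<close> y0] fp by (intro mult_mono) auto
    also have "\<dots> = (\<Prod>p\<in>prime_factors m. f p)"
      unfolding pf using y(2) by (subst prod.insert) (auto simp: in_prime_factors_iff)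
    finally show ?thesis .
  qed
qed

text \<open>
All factors are at most 1, so those at the primes outside \<open>Q\<close> may be dropped.
\<close>

lemma abs_admissible_le_prod:
  assumes f: "admissible f" and m: "m > 0" and Q: "finite Q" "\<And>p. p \<in> Q \<Longrightarrow> prime p"
  shows "\<bar>f m\<bar> \<le> (\<Prod>p | p \<in> Q \<and> p dvd m. f p)"
proof -
  have f01: "0 \<le> f p" "f p \<le> 1" if "prime p" for p using f that by (auto simp: admissible_def)
  let ?A = "{p. p \<in> Q \<and> p dvd m}"
  have sub: "?A \<subseteq> prime_factors m" using Q m by (auto simp: in_prime_factors_iff)
  have "(\<Prod>p\<in>prime_factors m. f p) = (\<Prod>p\<in>prime_factors m - ?A. f p) * (\<Prod>p\<in>?A. f p)"
    by (rule prod.subset_diff[OF sub]) simp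
  also have "\<dots> \<le> 1 * (\<Prod>p\<in>?A. f p)"
    using f01 Q by (intro mult_right_mono prod_le_1 prod_nonneg) (auto simp: in_prime_factors_iff)
  finally show ?thesis using abs_admissible_le[OF f m] by simp
qed

text \<open>
With \<open>w(P) = \<Prod> (1 - f p) \<Prod> f p\<close>, over \<open>p \<in> P\<close> and \<open>p \<in> Q - P\<close>, the probability that a random subset equals \<open>P\<close>, the product
of \<open>f p\<close> over the \<open>p \<in> Q\<close> dividing \<open>m\<close> is the probability that no element of the random set divides \<open>m\<close>. A
bound that is affine in the density \<open>V(P)\<close> can be averaged, and by independence the density averages to the product
of the means \<open>f p + (1 - f p) (1 - 1 / p)\<close>.
\<close>

lemma random_sieve_average:
  fixes f F :: "nat \<Rightarrow> real"
  assumes Q: "finite Q" and X: "finite X"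
    and f: "\<And>p. p \<in> Q \<Longrightarrow> 0 \<le> f p \<and> f p \<le> 1"
    and bound: "\<And>P. P \<subseteq> Q \<Longrightarrow> (\<Sum>m | m \<in> X \<and> (\<forall>p\<in>P. \<not> p dvd m). F m) \<le> \<alpha> * (\<Prod>p\<in>P. 1 - 1 / real p) + \<beta>"
  shows "(\<Sum>m\<in>X. (\<Prod>p | p \<in> Q \<and> p dvd m. f p) * F m) \<le> \<alpha> * (\<Prod>p\<in>Q. 1 - (1 - f p) / real p) + \<beta>"
proof -
  define w where "w P = (\<Prod>p\<in>P. 1 - f p) * (\<Prod>p\<in>Q - P. f p)" for P
  have w: "w P \<ge> 0" if "P \<subseteq> Q" for P
    unfolding w_def using that f by (intro mult_nonneg_nonneg prod_nonneg) auto
  have expand: "(\<Prod>p | p \<in> Q \<and> p dvd m. f p) = (\<Sum>P\<in>Pow Q. if \<forall>p\<in>P. \<not> p dvd m then w P else 0)" for m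
  proof -
    have "(\<Prod>p | p \<in> Q \<and> p dvd m. f p) = (\<Prod>p\<in>Q. if p dvd m then f p else 1)"
      by (rule prod.inter_filter[OF Q])
    also have "\<dots> = (\<Prod>p\<in>Q. (if p dvd m then 0 else 1 - f p) + f p)"
      by (intro prod.cong refl) auto
    also have "\<dots> = (\<Sum>P\<in>Pow Q. (\<Prod>p\<in>P. if p dvd m then 0 else 1 - f p) * (\<Prod>p\<in>Q - P. f p))"
      by (rule prod_add[OF Q])
    also have "\<dots> = (\<Sum>P\<in>Pow Q. if \<forall>p\<in>P. \<not> p dvd m then w P else 0)"
    proof (intro sum.cong refl)
      fix P assume "P \<in> Pow Q"
      then have finP: "finite P" using Q finite_subset by auto
      show "(\<Prod>p\<in>P. if p dvd m then 0 else 1 - f p) * (\<Prod>p\<in>Q - P. f p)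
          = (if \<forall>p\<in>P. \<not> p dvd m then w P else 0)"
      proof (cases "\<forall>p\<in>P. \<not> p dvd m")
        case True
        then have "(\<Prod>p\<in>P. if p dvd m then 0 else 1 - f p) = (\<Prod>p\<in>P. 1 - f p)"
          by (intro prod.cong) auto
        then show ?thesis using True by (simp add: w_def)
      next
        case False
        then obtain p where "p \<in> P" "p dvd m" by auto
        then have "(\<Prod>p\<in>P. if p dvd m then 0 else 1 - f p) = 0"
          using finP by (intro prod_zero) auto
        then show ?thesis unfolding if_not_P[OF False] by simp
      qed
    qed
    finally show ?thesis .
  qed
  have total: "(\<Sum>P\<in>Pow Q. w P) = 1"
    unfolding w_def prod_add[OF Q, symmetric] by simp
  have mean: "(\<Sum>P\<in>Pow Q. w P * (\<Prod>p\<in>P. 1 - 1 / real p)) = (\<Prod>p\<in>Q. 1 - (1 - f p) / real p)"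
  proof -
    have "(\<Sum>P\<in>Pow Q. w P * (\<Prod>p\<in>P. 1 - 1 / real p))
        = (\<Sum>P\<in>Pow Q. (\<Prod>p\<in>P. (1 - f p) * (1 - 1 / real p)) * (\<Prod>p\<in>Q - P. f p))"
      unfolding w_def prod.distrib by (simp only: mult_ac)
    also have "\<dots> = (\<Prod>p\<in>Q. (1 - f p) * (1 - 1 / real p) + f p)"
      by (rule prod_add[OF Q, symmetric])
    also have "\<dots> = (\<Prod>p\<in>Q. 1 - (1 - f p) / real p)"
      by (intro prod.cong refl) (simp add: algebra_simps diff_divide_distrib)
    finally show ?thesis .
  qed
  have "(\<Sum>m\<in>X. (\<Prod>p | p \<in> Q \<and> p dvd m. f p) * F m)
      = (\<Sum>m\<in>X. \<Sum>P\<in>Pow Q. if \<forall>p\<in>P. \<not> p dvd m then w P * F m else 0)"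
    unfolding expand sum_distrib_right by (intro sum.cong refl) auto
  also have "\<dots> = (\<Sum>P\<in>Pow Q. \<Sum>m\<in>X. if \<forall>p\<in>P. \<not> p dvd m then w P * F m else 0)"
    by (rule sum.swap)
  also have "\<dots> = (\<Sum>P\<in>Pow Q. w P * (\<Sum>m | m \<in> X \<and> (\<forall>p\<in>P. \<not> p dvd m). F m))"
    unfolding sum_distrib_left by (intro sum.cong refl sum.inter_filter[OF X, symmetric])
  also have "\<dots> \<le> (\<Sum>P\<in>Pow Q. w P * (\<alpha> * (\<Prod>p\<in>P. 1 - 1 / real p) + \<beta>))"
    by (intro sum_mono mult_left_mono bound w) auto
  also have "\<dots> = \<alpha> * (\<Sum>P\<in>Pow Q. w P * (\<Prod>p\<in>P. 1 - 1 / real p)) + \<beta> * (\<Sum>P\<in>Pow Q. w P)"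
    unfolding sum_distrib_left sum.distrib[symmetric] by (intro sum.cong refl) (simp add: algebra_simps)
  finally show ?thesis unfolding mean total by simp
qed

lemma sum_abs_admissible_le:
  assumes f: "admissible f" and z: "z > 1"
  shows "(\<Sum>m\<in>{1..x}. \<bar>f m\<bar>)
    \<le> 2 * real x * (\<Prod>p | prime p \<and> real p \<le> z. 1 - (1 - f p) / real p) + z ^ 20"
proof -
  let ?Q = "{p. prime p \<and> real p \<le> z}"
  have finQ: "finite ?Q" by (rule finite_subset[of _ "{..nat \<lfloor>z\<rfloor>}"]) (auto simp: le_nat_floor)
  have "(\<Sum>m\<in>{1..x}. \<bar>f m\<bar>) \<le> (\<Sum>m\<in>{1..x}. (\<Prod>p | p \<in> ?Q \<and> p dvd m. f p) * 1)"
    using abs_admissible_le_prod[OF f _ finQ] by (intro sum_mono) auto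
  also have "\<dots> \<le> 2 * real x * (\<Prod>p\<in>?Q. 1 - (1 - f p) / real p) + z ^ 20"
  proof (rule random_sieve_average[OF finQ])
    fix P assume P: "P \<subseteq> ?Q"
    then have P': "finite P" "\<And>p. p \<in> P \<Longrightarrow> prime p \<and> real p \<le> z" using finQ finite_subset by auto
    obtain nu where nu: "\<forall>m. nu m \<ge> 0" "\<forall>m. (\<forall>p\<in>P. \<not> p dvd m) \<longrightarrow> nu m = 1"
      "\<forall>x. (\<Sum>m\<in>{1..x}. nu m) \<le> 2 * real x * (\<Prod>p\<in>P. 1 - 1 / real p) + z ^ 20"
      using Selberg_majorant[OF P' z] by blast
    have "(\<Sum>m | m \<in> {1..x} \<and> (\<forall>p\<in>P. \<not> p dvd m). 1) = (\<Sum>m | m \<in> {1..x} \<and> (\<forall>p\<in>P. \<not> p dvd m). nu m)"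
      using nu(2) by (intro sum.cong refl) simp
    also have "\<dots> \<le> (\<Sum>m\<in>{1..x}. nu m)"
      using nu(1) by (intro sum_mono2) auto
    also have "\<dots> \<le> 2 * real x * (\<Prod>p\<in>P. 1 - 1 / real p) + z ^ 20" using nu(3) by blast
    finally show "(\<Sum>m | m \<in> {1..x} \<and> (\<forall>p\<in>P. \<not> p dvd m). 1) \<le> 2 * real x * (\<Prod>p\<in>P. 1 - 1 / real p) + z ^ 20" .
  qed (use f in \<open>auto simp: admissible_def\<close>)
  finally show ?thesis .
qed

lemma weighted_second_moment_le:
  fixes c :: "nat \<Rightarrow> complex"
  assumes f: "admissible f" and z: "z > 1"
    and I: "I \<subseteq> {n \<in> {1..N}. odd n}" "\<And>n. n \<in> I \<Longrightarrow> W < real n" and W: "W > 0" and N: "N \<ge> 1"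
    and c: "\<And>n. n \<in> I \<Longrightarrow> norm (c n) \<le> 1 / real n"
  shows "(\<Sum>m\<in>{1..x}. \<bar>f m\<bar> * (norm (\<Sum>n\<in>I. c n * of_real (odd_Jacobi n m)))\<^sup>2)
    \<le> (2 * real x * (\<Prod>p | prime p \<and> real p \<le> z. 1 - (1 - f p) / real p) + z ^ 20) * (4 / W * (1 + ln (real N)))
       + z ^ 20 * (8 * real N * (1 + 2 * ln (real N)))"
proof -
  let ?Q = "{p. prime p \<and> real p \<le> z}"
  let ?F = "\<lambda>m. (norm (\<Sum>n\<in>I. c n * of_real (odd_Jacobi n m)))\<^sup>2"
  let ?O = "z ^ 20 * (8 * real N * (1 + 2 * ln (real N)))"
  have finQ: "finite ?Q" by (rule finite_subset[of _ "{..nat \<lfloor>z\<rfloor>}"]) (auto simp: le_nat_floor)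
  define D where "D = (\<Sum>(a, b) | a \<in> I \<and> b \<in> I \<and> is_nth_power 2 (a * b). 1 / (real a * real b))"
  have D: "D \<le> 4 / W * (1 + ln (real N))"
    unfolding D_def by (rule diagonal_sum_le[OF W _ N]) (use I in auto)
  define E where "E = (\<Prod>p\<in>?Q. 1 - (1 - f p) / real p)"
  have E: "E \<ge> 0" unfolding E_def
  proof (rule prod_nonneg)
    fix p assume "p \<in> ?Q"
    then have "(1 - f p) / real p \<le> 1 / 1"
      using f prime_ge_1_nat[of p] by (intro frac_le) (auto simp: admissible_def)
    then show "0 \<le> 1 - (1 - f p) / real p" by simp
  qed
  have "(\<Sum>m\<in>{1..x}. \<bar>f m\<bar> * ?F m) \<le> (\<Sum>m\<in>{1..x}. (\<Prod>p | p \<in> ?Q \<and> p dvd m. f p) * ?F m)"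
    using abs_admissible_le_prod[OF f _ finQ] by (intro sum_mono mult_right_mono) auto
  also have "\<dots> \<le> (2 * real x * D) * (\<Prod>p\<in>?Q. 1 - (1 - f p) / real p) + (z ^ 20 * D + ?O)"
  proof (rule random_sieve_average[OF finQ])
    fix P assume P: "P \<subseteq> ?Q"
    then have P': "finite P" "\<And>p. p \<in> P \<Longrightarrow> prime p \<and> real p \<le> z" using finQ finite_subset by auto
    have "(\<Sum>m | m \<in> {1..x} \<and> (\<forall>p\<in>P. \<not> p dvd m). ?F m)
        \<le> (2 * real x * (\<Prod>p\<in>P. 1 - 1 / real p) + z ^ 20) * D + ?O"
      unfolding D_def by (rule sifted_second_moment_le[OF P' z I(1) N c])
    also have "\<dots> = (2 * real x * D) * (\<Prod>p\<in>P. 1 - 1 / real p) + (z ^ 20 * D + ?O)"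
      by (simp add: algebra_simps)
    finally show "(\<Sum>m | m \<in> {1..x} \<and> (\<forall>p\<in>P. \<not> p dvd m). ?F m)
        \<le> (2 * real x * D) * (\<Prod>p\<in>P. 1 - 1 / real p) + (z ^ 20 * D + ?O)" .
  qed (use f in \<open>auto simp: admissible_def\<close>)
  also have "\<dots> = (2 * real x * E + z ^ 20) * D + ?O" unfolding E_def by (simp add: algebra_simps)
  also have "\<dots> \<le> (2 * real x * E + z ^ 20) * (4 / W * (1 + ln (real N))) + ?O"
    using D E z by (intro add_right_mono mult_left_mono) auto
  finally show ?thesis unfolding E_def .
qed

lemma weighted_Cauchy_Schwarz:
  fixes g A :: "'a \<Rightarrow> real"
  assumes "\<And>m. m \<in> X \<Longrightarrow> g m \<ge> 0"
  shows "(\<Sum>m\<in>X. g m * A m) \<le> sqrt ((\<Sum>m\<in>X. g m) * (\<Sum>m\<in>X. g m * (A m)\<^sup>2))"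
proof -
  have "(\<Sum>m\<in>X. g m * A m)\<^sup>2 = (\<Sum>m\<in>X. sqrt (g m) * (sqrt (g m) * A m))\<^sup>2"
    using assms by (intro arg_cong[where f = "\<lambda>x. x\<^sup>2"] sum.cong refl) (simp flip: mult.assoc)
  also have "\<dots> \<le> (\<Sum>m\<in>X. (sqrt (g m))\<^sup>2) * (\<Sum>m\<in>X. (sqrt (g m) * A m)\<^sup>2)"
    by (rule Cauchy_Schwarz_ineq_sum)
  also have "\<dots> = (\<Sum>m\<in>X. g m) * (\<Sum>m\<in>X. g m * (A m)\<^sup>2)"
    using assms by (simp add: power_mult_distrib)
  finally show ?thesis by (rule real_le_rsqrt)
qed

section \<open>The bilinear bound\<close>

text \<open>
If \<open>M powr \<eta> < 2\<close> there is nothing to sieve by, but then \<open>M\<close> is bounded in terms of \<open>\<eta>\<close> and the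
right-hand side is at least 1.
\<close>

lemma sieve_density_power_le:
  assumes f: "\<And>p. prime p \<Longrightarrow> 0 \<le> f p \<and> f p \<le> 1" and m: "mertens_mean f \<alpha> K"
    and \<alpha>: "0 < \<alpha>" "\<alpha> < 1" and M: "M \<ge> 2" and \<eta>: "0 < \<eta>" "\<eta> \<le> 1"
  shows "(\<Prod>p | prime p \<and> real p \<le> M powr \<eta>. 1 - (1 - f p) / real p)
    \<le> 2 * exp \<bar>K\<bar> / \<eta> * ln M powr (\<alpha> - 1)"
proof (cases "M powr \<eta> \<ge> 2")
  case True
  have lnM: "ln M > 0" using M by simp
  have "(\<Prod>p | prime p \<and> real p \<le> M powr \<eta>. 1 - (1 - f p) / real p) \<le> 2 * exp K * ln (M powr \<eta>) powr (\<alpha> - 1)"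
    by (rule sieve_density_le[OF f m True])
  also have "ln (M powr \<eta>) powr (\<alpha> - 1) = \<eta> powr (\<alpha> - 1) * ln M powr (\<alpha> - 1)"
    using \<eta> lnM M by (simp add: ln_powr powr_mult)
  also have "2 * exp K * \<dots> \<le> 2 * exp \<bar>K\<bar> * (\<eta> powr (- 1) * ln M powr (\<alpha> - 1))"
    using \<eta> \<alpha> by (intro mult_mono mult_left_mono mult_right_mono powr_mono') auto
  finally show ?thesis using \<eta> by (simp add: powr_minus_divide)
next
  case False
  have lnM: "ln M > 0" using M by simp
  have none: "{p. prime p \<and> real p \<le> M powr \<eta>} = {}"
  proof -
    have "\<not> (prime p \<and> real p \<le> M powr \<eta>)" for p
    proof
      assume p: "prime p \<and> real p \<le> M powr \<eta>"
      then have "2 \<le> p" using prime_ge_2_nat by blast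
      then have "2 \<le> real p" by simp
      with p False show False by linarith
    qed
    then show ?thesis by blast
  qed
  have "\<eta> * ln M = ln (M powr \<eta>)" using M by (simp add: ln_powr)
  also have "\<dots> \<le> ln 2"
  proof -
    have "0 < M powr \<eta>" "M powr \<eta> \<le> 2" using False M by auto
    then show ?thesis by (rule ln_mono[rotated])
  qed
  also have "\<dots> \<le> 1" using ln_le_minus_one[of 2] by simp
  finally have "ln M \<le> 1 / \<eta>" using \<eta> by (simp add: field_simps)
  then have "(1 / \<eta>) powr (\<alpha> - 1) \<le> ln M powr (\<alpha> - 1)"
    using lnM \<alpha> by (intro powr_mono2') auto
  moreover have "\<eta> powr 1 \<le> (1 / \<eta>) powr (\<alpha> - 1)"
  proof -
    have "(1 / \<eta>) powr (\<alpha> - 1) = \<eta> powr (1 - \<alpha>)"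
      using \<eta> powr_minus_divide[of "1 / \<eta>" "1 - \<alpha>"] by (simp add: powr_divide)
    then show ?thesis using powr_mono'[of "1 - \<alpha>" 1 \<eta>] \<eta> \<alpha> by simp
  qed
  ultimately have "\<eta> \<le> ln M powr (\<alpha> - 1)" using \<eta> by simp
  then have "1 \<le> 1 * (ln M powr (\<alpha> - 1) / \<eta>)" using \<eta> by simp
  also have "1 * (ln M powr (\<alpha> - 1) / \<eta>) \<le> 2 * exp \<bar>K\<bar> * (ln M powr (\<alpha> - 1) / \<eta>)"
  proof (rule mult_right_mono)
    show "1 \<le> 2 * exp \<bar>K\<bar>"
      using exp_ge_add_one_self[of "\<bar>K\<bar>"] abs_ge_zero[of K] by linarith
  qed (use \<eta> in simp)
  finally show ?thesis unfolding none by simp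
qed

text \<open>
Any power saving beats the logarithm: this absorbs the sieve error \<open>z\<^sup>2\<^sup>0\<close> into the main term.
\<close>

lemma sqrt_le_mult_ln_powr:
  fixes M \<alpha> :: real
  assumes M: "M \<ge> 2" and \<alpha>: "0 < \<alpha>" "\<alpha> < 1"
  shows "M powr (1 / 2) \<le> 2 * (M * ln M powr (\<alpha> - 1))"
proof -
  have lnM: "ln M > 0" using M by simp
  have "ln M = 2 * ln (sqrt M)" using M by (simp add: ln_sqrt)
  also have "\<dots> \<le> 2 * sqrt M" using ln_le_minus_one[of "sqrt M"] M by simp
  finally have "(2 * sqrt M) powr (\<alpha> - 1) \<le> ln M powr (\<alpha> - 1)"
    using lnM \<alpha> by (intro powr_mono2') auto
  moreover have "(2 * sqrt M) powr (- 1) \<le> (2 * sqrt M) powr (\<alpha> - 1)"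
  proof -
    have "sqrt M \<ge> 1" using M by simp
    then have "2 * sqrt M \<ge> 1" by linarith
    then show ?thesis using \<alpha> by (intro powr_mono) auto
  qed
  ultimately have "1 / (2 * sqrt M) \<le> ln M powr (\<alpha> - 1)"
    using M by (simp add: powr_minus_divide)
  then have "2 * M * (1 / (2 * sqrt M)) \<le> 2 * M * ln M powr (\<alpha> - 1)"
    using M by (intro mult_left_mono) auto
  moreover have "2 * M * (1 / (2 * sqrt M)) = sqrt M"
    using M by (simp add: real_div_sqrt)
  ultimately show ?thesis using M by (simp add: powr_half_sqrt mult_ac)
qed

text \<open>
The exponent \<open>\<eta>\<close> has to satisfy two conditions: the sieve error \<open>z\<^sup>2\<^sup>0\<close> must be at most \<open>sqrt M\<close> to be
absorbed in the mean of \<open>\<bar>f\<bar>\<close>, and its square root \<open>z\<^sup>1\<^sup>0\<close> must be at most \<open>M powr \<epsilon>\<close>.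
\<close>

theorem corollary1p2:
  fixes \<epsilon> K :: real
  assumes "\<epsilon> > 0"
  shows "\<exists>C>0. \<forall>(M::real) (N::real) (W::real) (\<alpha>::real) (f::nat \<Rightarrow> real)
      (a::nat \<Rightarrow> complex) (b::nat \<Rightarrow> complex).
    M \<ge> N \<longrightarrow> N \<ge> W \<longrightarrow> W \<ge> 2 \<longrightarrow>
    admissible f \<longrightarrow> 0 < \<alpha> \<longrightarrow> \<alpha> < 1 \<longrightarrow> mertens_mean f \<alpha> K \<longrightarrow>
    (\<forall>n>0. cmod (a n) \<le> 1) \<longrightarrow> (\<forall>m>0. cmod (b m) \<le> 1) \<longrightarrow>
    (\<forall>n>0. even n \<longrightarrow> a n = 0) \<longrightarrow> (\<forall>m>0. even m \<longrightarrow> b m = 0) \<longrightarrow>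
    cmod (\<Sum>n | W < real n \<and> real n \<le> N. \<Sum>m | 0 < m \<and> real m \<le> M.
        a n / of_nat n * b m * of_real (f m) * of_int (Jacobi (int n) m))
    \<le> C * (M * ln N / (W powr (1 / 2) * ln M powr (1 - \<alpha>))
          + M powr (1 / 2 + \<epsilon>) * N powr (1 / 2) * ln N powr (1 / 2)
              / ln M powr ((1 - \<alpha>) / 2))"
proof -
  define \<eta> where "\<eta> = min (\<epsilon> / 10) (1 / 40)"
  define C1 where "C1 = 2 * exp \<bar>K\<bar> / \<eta>"
  \<comment> \<open>\<open>C2\<close> collects the sieve main term \<open>2 C1\<close> and the absorbed error; the factor 7 below comes from
    \<open>12 ln N \<le> (7 ln N)\<^sup>2\<close>, as \<open>ln N \<ge> 1 / 2\<close>, and from \<open>32 C2 \<le> (7 C2)\<^sup>2\<close>\<close>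
  define C2 where "C2 = 2 * C1 + 2"
  have \<eta>: "\<eta> > 0" "\<eta> \<le> 1" "10 * \<eta> \<le> \<epsilon>" "20 * \<eta> \<le> 1 / 2"
    using assms by (auto simp: \<eta>_def)
  have C1: "C1 \<ge> 0" using \<eta> by (simp add: C1_def)
  have C2: "C2 \<ge> 1" using C1 by (simp add: C2_def)
  show ?thesis
  proof (intro exI[of _ "7 * C2"] conjI allI impI)
    show "7 * C2 > 0" using C2 by simp
  next
    fix M N W \<alpha> :: real and f :: "nat \<Rightarrow> real" and a b :: "nat \<Rightarrow> complex"
    assume MN: "M \<ge> N" and NW: "N \<ge> W" and W: "W \<ge> 2" and f: "admissible f"
      and \<alpha>: "0 < \<alpha>" "\<alpha> < 1" and mert: "mertens_mean f \<alpha> K"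
      and a: "\<forall>n>0. cmod (a n) \<le> 1" and b: "\<forall>m>0. cmod (b m) \<le> 1"
      and a_even: "\<forall>n>0. even n \<longrightarrow> a n = 0" and b_even: "\<forall>m>0. even m \<longrightarrow> b m = 0"
    have M2: "M \<ge> 2" and N2: "N \<ge> 2" using MN NW W by auto
    define z where "z = M powr \<eta>"
    define x where "x = nat \<lfloor>M\<rfloor>"
    define N0 where "N0 = nat \<lfloor>N\<rfloor>"
    define I where "I = {n. W < real n \<and> real n \<le> N \<and> odd n}"
    define A where "A m = (\<Sum>n\<in>I. (a n / of_nat n) * of_real (odd_Jacobi n m))" for m
    define L where "L = ln M powr (\<alpha> - 1)"
    define E where "E = (\<Prod>p | prime p \<and> real p \<le> z. 1 - (1 - f p) / real p)"
    define T where "T = C2 * (M * L)"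
    have z1: "z > 1" using M2 \<eta> by (simp add: z_def)
    have lnM: "ln M > 0" using M2 by simp
    have L: "L > 0" using lnM by (simp add: L_def)
    have lnN: "ln N \<ge> 1 / 2"
    proof -
      have "ln (2::real) \<ge> 1 / 2" using ln2_ge_two_thirds by linarith
      moreover have "ln N \<ge> ln 2" using N2 by simp
      ultimately show ?thesis by linarith
    qed
    have x: "real x \<le> M" unfolding x_def using M2 by simp
    have N0: "real N0 \<le> N" "N0 \<ge> 1" unfolding N0_def using N2 by (simp_all add: le_nat_iff)
    then have ln_N0: "0 \<le> ln (real N0)" "ln (real N0) \<le> ln N" by auto
    have z20: "z ^ 20 = M powr (20 * \<eta>)" and z10: "z ^ 10 = M powr (10 * \<eta>)"
      using M2 by (simp_all add: z_def powr_power mult.commute)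
    have z20_le: "z ^ 20 \<le> 2 * (M * L)"
    proof -
      have "z ^ 20 \<le> M powr (1 / 2)" unfolding z20 using \<eta> M2 by (intro powr_mono) auto
      also have "\<dots> \<le> 2 * (M * L)" unfolding L_def by (rule sqrt_le_mult_ln_powr[OF M2 \<alpha>])
      finally show ?thesis .
    qed
    have E_le: "E \<le> C1 * L"
      unfolding E_def z_def C1_def L_def
      by (rule sieve_density_power_le[OF _ mert \<alpha> M2]) (use f \<eta> in \<open>auto simp: admissible_def\<close>)
    have sieve_le: "2 * real x * E + z ^ 20 \<le> T"
    proof -
      have "real x * E \<le> M * (C1 * L)"
        using x E_le C1 L M2 by (intro order.trans[OF mult_left_mono[OF E_le] mult_right_mono]) auto
      then show ?thesis using z20_le by (simp add: T_def C2_def algebra_simps)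
    qed
    have T: "T \<ge> 0" using C2 M2 L by (simp add: T_def)
    have S1: "(\<Sum>m\<in>{1..x}. \<bar>f m\<bar>) \<le> T"
      using sum_abs_admissible_le[OF f z1, of x] sieve_le unfolding E_def by linarith
    have S2: "(\<Sum>m\<in>{1..x}. \<bar>f m\<bar> * (norm (A m))\<^sup>2) \<le> T * (12 * ln N / W) + z ^ 20 * (32 * N * ln N)"
    proof -
      have "(\<Sum>m\<in>{1..x}. \<bar>f m\<bar> * (norm (A m))\<^sup>2)
          \<le> (2 * real x * E + z ^ 20) * (4 / W * (1 + ln (real N0))) + z ^ 20 * (8 * real N0 * (1 + 2 * ln (real N0)))"
        unfolding A_def E_def
      proof (rule weighted_second_moment_le[OF f z1])
        show "I \<subseteq> {n \<in> {1..N0}. odd n}"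
          using W by (auto simp: I_def N0_def le_nat_floor intro!: Suc_leI gr0I)
        show "W < real n" if "n \<in> I" for n using that by (simp add: I_def)
        show "norm (a n / of_nat n) \<le> 1 / real n" if "n \<in> I" for n
        proof -
          have "n > 0" using that W by (auto simp: I_def intro: gr0I)
          then show ?thesis using a by (simp add: norm_divide divide_right_mono)
        qed
      qed (use W N0 in auto)
      also have "\<dots> \<le> T * (4 / W * (3 * ln N)) + z ^ 20 * (8 * N * (4 * ln N))"
      proof -
        have "1 + ln (real N0) \<le> 3 * ln N" "1 + 2 * ln (real N0) \<le> 4 * ln N"
          using ln_N0 lnN by linarith+
        then show ?thesis
          using sieve_le T W ln_N0(1) N0 N2 z1
          by (intro add_mono mult_mono mult_left_mono) (auto intro: mult_nonneg_nonneg)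
      qed
      finally show ?thesis by (simp add: mult_ac)
    qed
    have sets: "{m. 0 < m \<and> real m \<le> M} = {1..x}"
      using M2 by (auto simp: x_def le_nat_floor le_nat_iff le_floor_iff Suc_le_eq)
    have finN: "finite {n. W < real n \<and> real n \<le> N}"
      by (rule finite_subset[of _ "{..N0}"]) (auto simp: N0_def le_nat_floor)
    have "(\<Sum>n | W < real n \<and> real n \<le> N. \<Sum>m | 0 < m \<and> real m \<le> M.
        a n / of_nat n * b m * of_real (f m) * of_int (Jacobi (int n) m))
      = (\<Sum>m\<in>{1..x}. \<Sum>n | W < real n \<and> real n \<le> N.
        a n / of_nat n * b m * of_real (f m) * of_int (Jacobi (int n) m))"
      unfolding sets by (rule sum.swap)
    also have "\<dots> = (\<Sum>m\<in>{1..x}. b m * of_real (f m) * A m)"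
    proof (rule sum.cong[OF refl])
      fix m assume m: "m \<in> {1..x}"
      show "(\<Sum>n | W < real n \<and> real n \<le> N. a n / of_nat n * b m * of_real (f m) * of_int (Jacobi (int n) m))
          = b m * of_real (f m) * A m"
      proof (cases "even m")
        case True
        then have "b m = 0" using b_even m by auto
        then show ?thesis by simp
      next
        case False
        have "(\<Sum>n | W < real n \<and> real n \<le> N. a n / of_nat n * b m * of_real (f m) * of_int (Jacobi (int n) m))
          = (\<Sum>n\<in>I. a n / of_nat n * b m * of_real (f m) * of_int (Jacobi (int n) m))"
        proof (rule sum.mono_neutral_right[OF finN])
          show "\<forall>n\<in>{n. W < real n \<and> real n \<le> N} - I.
              a n / of_nat n * b m * of_real (f m) * of_int (Jacobi (int n) m) = 0"
            using a_even W by (auto simp: I_def intro: gr0I)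
        qed (auto simp: I_def)
        also have "\<dots> = b m * of_real (f m) * A m"
          using False by (simp add: A_def sum_distrib_left odd_Jacobi_def mult_ac)
        finally show ?thesis .
      qed
    qed
    also have "norm \<dots> \<le> (\<Sum>m\<in>{1..x}. \<bar>f m\<bar> * norm (A m))"
    proof (rule sum_norm_le)
      fix m assume "m \<in> {1..x}"
      then have "norm (b m) \<le> 1" using b by auto
      then have "norm (b m) * (\<bar>f m\<bar> * norm (A m)) \<le> 1 * (\<bar>f m\<bar> * norm (A m))"
        by (intro mult_right_mono) auto
      then show "norm (b m * of_real (f m) * A m) \<le> \<bar>f m\<bar> * norm (A m)"
        by (simp add: norm_mult mult.assoc)
    qed
    also have "\<dots> \<le> sqrt ((\<Sum>m\<in>{1..x}. \<bar>f m\<bar>) * (\<Sum>m\<in>{1..x}. \<bar>f m\<bar> * (norm (A m))\<^sup>2))"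
      by (rule weighted_Cauchy_Schwarz) auto
    also have "\<dots> \<le> sqrt (T * (T * (12 * ln N / W) + z ^ 20 * (32 * N * ln N)))"
      by (intro real_sqrt_le_mono mult_mono S1 S2 T) (auto intro: sum_nonneg)
    also have "\<dots> \<le> sqrt ((7 * T * ln N / sqrt W)\<^sup>2) + sqrt ((7 * C2 * (sqrt (M * L) * z ^ 10 * sqrt (N * ln N)))\<^sup>2)"
    proof -
      have "T * (T * (12 * ln N / W)) = T\<^sup>2 / W * (12 * ln N)"
        by (simp add: power2_eq_square)
      also have "\<dots> \<le> T\<^sup>2 / W * (49 * (ln N)\<^sup>2)"
      proof (rule mult_left_mono)
        have "12 * ln N \<le> (49 * ln N) * ln N" using lnN by (intro mult_right_mono) auto
        then show "12 * ln N \<le> 49 * (ln N)\<^sup>2" by (simp add: power2_eq_square)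
      qed (use W in auto)
      also have "\<dots> = (7 * T * ln N / sqrt W)\<^sup>2"
        using W by (simp add: power_mult_distrib power_divide)
      finally have 1: "T * (T * (12 * ln N / W)) \<le> (7 * T * ln N / sqrt W)\<^sup>2" .
      have "T * (z ^ 20 * (32 * N * ln N)) = 32 * C2 * ((M * L) * z ^ 20 * (N * ln N))"
        by (simp add: T_def mult_ac)
      also have "\<dots> \<le> (49 * C2\<^sup>2) * ((M * L) * z ^ 20 * (N * ln N))"
      proof (rule mult_right_mono)
        have "32 * C2 \<le> (49 * C2) * C2" using C2 by (intro mult_right_mono) auto
        then show "32 * C2 \<le> 49 * C2\<^sup>2" by (simp add: power2_eq_square)
      qed (use M2 L z1 N2 lnN in auto)
      also have "\<dots> = (7 * C2 * (sqrt (M * L) * z ^ 10 * sqrt (N * ln N)))\<^sup>2"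
      proof -
        have "(sqrt (M * L))\<^sup>2 = M * L" "(sqrt (N * ln N))\<^sup>2 = N * ln N"
          using M2 L N2 lnN by auto
        moreover have "(z ^ 10)\<^sup>2 = z ^ 20" by (simp flip: power_mult)
        ultimately show ?thesis by (simp only: power_mult_distrib) simp
      qed
      finally have 2: "T * (z ^ 20 * (32 * N * ln N)) \<le> (7 * C2 * (sqrt (M * L) * z ^ 10 * sqrt (N * ln N)))\<^sup>2" .
      have "sqrt (T * (T * (12 * ln N / W) + z ^ 20 * (32 * N * ln N)))
          \<le> sqrt ((7 * T * ln N / sqrt W)\<^sup>2 + (7 * C2 * (sqrt (M * L) * z ^ 10 * sqrt (N * ln N)))\<^sup>2)"
        unfolding distrib_left by (intro real_sqrt_le_mono add_mono 1 2)
      also have "\<dots> \<le> sqrt ((7 * T * ln N / sqrt W)\<^sup>2) + sqrt ((7 * C2 * (sqrt (M * L) * z ^ 10 * sqrt (N * ln N)))\<^sup>2)"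
        by (rule sqrt_add_le_add_sqrt) auto
      finally show ?thesis .
    qed
    also have "\<dots> = 7 * C2 * (M * L * ln N / sqrt W + sqrt (M * L) * z ^ 10 * sqrt (N * ln N))"
    proof -
      have "7 * T * ln N / sqrt W \<ge> 0" "7 * C2 * (sqrt (M * L) * z ^ 10 * sqrt (N * ln N)) \<ge> 0"
        using T C2 lnN W z1 M2 N2 L by (auto intro!: mult_nonneg_nonneg divide_nonneg_nonneg)
      then have "sqrt ((7 * T * ln N / sqrt W)\<^sup>2) + sqrt ((7 * C2 * (sqrt (M * L) * z ^ 10 * sqrt (N * ln N)))\<^sup>2)
          = 7 * T * ln N / sqrt W + 7 * C2 * (sqrt (M * L) * z ^ 10 * sqrt (N * ln N))"
        by (simp only: real_sqrt_abs abs_of_nonneg)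
      then show ?thesis by (simp add: T_def algebra_simps)
    qed
    also have "\<dots> \<le> 7 * C2 * (M * ln N / (W powr (1 / 2) * ln M powr (1 - \<alpha>))
          + M powr (1 / 2 + \<epsilon>) * N powr (1 / 2) * ln N powr (1 / 2) / ln M powr ((1 - \<alpha>) / 2))"
    proof (intro mult_left_mono add_mono)
      have "L = 1 / ln M powr (1 - \<alpha>)"
        unfolding L_def using powr_minus_divide[of "ln M" "1 - \<alpha>"] by simp
      then show "M * L * ln N / sqrt W \<le> M * ln N / (W powr (1 / 2) * ln M powr (1 - \<alpha>))"
        using W by (simp add: powr_half_sqrt mult.commute)
      have sqrtL: "sqrt L = 1 / ln M powr ((1 - \<alpha>) / 2)"
      proof -
        have "sqrt L = L powr (1 / 2)" using L by (simp add: powr_half_sqrt)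
        also have "\<dots> = ln M powr (- ((1 - \<alpha>) / 2))"
          unfolding L_def powr_powr by (rule arg_cong[where f = "\<lambda>t. ln M powr t"]) (simp add: field_simps)
        finally show ?thesis by (simp add: powr_minus_divide)
      qed
      have "z ^ 10 \<le> M powr \<epsilon>" unfolding z10 using \<eta> M2 by (intro powr_mono) auto
      then have "sqrt (M * L) * z ^ 10 * sqrt (N * ln N) \<le> sqrt (M * L) * M powr \<epsilon> * sqrt (N * ln N)"
        using M2 L N2 lnN by (intro mult_right_mono mult_left_mono) auto
      also have "\<dots> = M powr (1 / 2 + \<epsilon>) * N powr (1 / 2) * ln N powr (1 / 2) / ln M powr ((1 - \<alpha>) / 2)"
        using M2 N2 lnN by (simp add: real_sqrt_mult sqrtL powr_half_sqrt powr_add)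
      finally show "sqrt (M * L) * z ^ 10 * sqrt (N * ln N)
          \<le> M powr (1 / 2 + \<epsilon>) * N powr (1 / 2) * ln N powr (1 / 2) / ln M powr ((1 - \<alpha>) / 2)" .
    qed (use C2 in auto)
    finally show "cmod (\<Sum>n | W < real n \<and> real n \<le> N. \<Sum>m | 0 < m \<and> real m \<le> M.
        a n / of_nat n * b m * of_real (f m) * of_int (Jacobi (int n) m))
      \<le> 7 * C2 * (M * ln N / (W powr (1 / 2) * ln M powr (1 - \<alpha>))
          + M powr (1 / 2 + \<epsilon>) * N powr (1 / 2) * ln N powr (1 / 2) / ln M powr ((1 - \<alpha>) / 2))" .
  qed
qed

end
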